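(* Let $A=\prod_{j=1}^s[a_j,A_j)$, $0\le a_j<A_j\le1$, be a box in $[0,1)^s$. Let $\hat\mu_{n,A}=\frac1n\sum_{i=1}^n \mathbf 1_A(U_i)$ be the estimator of $\mu_A=\mathrm{Vol}(A)$ based on a scrambled $(0,m,s)$-net $\tilde P_n=\{U_1,\dots,U_n\}$ in base $b$ with $n=b^m$. Then $$\mathrm{Var}(\hat\mu_{n,A})\le \frac{\mu_A(1-\mu_A)}{n}.$$
   Context: Integers $b\ge 2$, $s\ge 1$, $m\ge 1$ with $b\ge s$; $n=b^m$. A $(0,m,s)$-net in base $b$ is a set $P_n=\{u_1,\dots,u_n\}$ of $n=b^m$ points of $[0,1)^s$ such that for all integers $k_j\ge 0$ with $k_1+\dots+k_s\le m$ and all integers $0\le c_j<b^{k_j}$, the elementary interval $\prod_{j=1}^s[c_jb^{-k_j},(c_j+1)b^{-k_j})$ contains exactly $b^{m-(k_1+\dots+k_s)}$ points of $P_n$. Scrambling is Owen's nested uniform scrambling in base $b$: write each coordinate of each point in base $b$ as $x=0.x_1x_2x_3\ldots$ with $x_i=\lfloor b^ix\rfloor \bmod b$. For each coordinate $j$ and each finite digit string $(x_1,\dots,x_{i-1})$, $i\ge1$, let $\pi_{j;x_1,\dots,x_{i-1}}$ be a uniformly random permutation of $\{0,\dots,b-1\}$, all these permutations being mutually independent; the $i$th digit $x_i$ of the $j$th coordinate of a point is replaced by $\pi_{j;x_1,\dots,x_{i-1}}(x_i)$. The resulting random point set is $\tilde P_n=\{U_1,\dots,U_n\}$. *)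

theory Defs
  imports "HOL-Probability.Probability" "HOL-Combinatorics.Permutations"
begin

definition half_open_box :: "real ^ 's \<Rightarrow> real ^ 's \<Rightarrow> (real ^ 's) set" where
  "half_open_box a b = {x. \<forall>j. a $ j \<le> x $ j \<and> x $ j < b $ j}"

definition elementary_interval ::
    "nat \<Rightarrow> ('s \<Rightarrow> nat) \<Rightarrow> ('s \<Rightarrow> nat) \<Rightarrow> (real ^ 's) set" where
  "elementary_interval b k c =
     half_open_box (\<chi> j. real (c j) / real b ^ k j) (\<chi> j. (real (c j) + 1) / real b ^ k j)"

text \<open>A $(0,m,s)$-net in base $b$; the dimension $s$ is the cardinality of the index type.\<close>

definition zero_net :: "nat \<Rightarrow> nat \<Rightarrow> (real ^ 's::finite) set \<Rightarrow> bool" where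
  "zero_net b m P \<longleftrightarrow>
     finite P \<and> card P = b ^ m \<and> P \<subseteq> half_open_box 0 1 \<and>
     (\<forall>k c. (\<Sum>j\<in>UNIV. k j) \<le> m \<and> (\<forall>j. c j < b ^ k j) \<longrightarrow>
        card (P \<inter> elementary_interval b k c) = b ^ (m - (\<Sum>j\<in>UNIV. k j)))"

text \<open>Digits are numbered from 1, so that \<open>x = (\<Sum>i\<ge>1. digit b x i / b ^ i)\<close> for \<open>x\<close> in $[0,1)$.\<close>

definition digit :: "nat \<Rightarrow> real \<Rightarrow> nat \<Rightarrow> nat" where
  "digit b x i = nat (\<lfloor>real b ^ i * x\<rfloor> mod int b)"

text \<open>In \<open>scramble_digit b \<sigma> x i\<close>, the permutation applied to the \<open>i\<close>th digit is the one attached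
  to the string of the preceding (unscrambled) digits \<open>1, \<dots>, i - 1\<close>.\<close>

definition scramble_digit ::
    "nat \<Rightarrow> (nat list \<Rightarrow> nat \<Rightarrow> nat) \<Rightarrow> real \<Rightarrow> nat \<Rightarrow> nat" where
  "scramble_digit b \<sigma> x i = \<sigma> (map (digit b x) [1..<i]) (digit b x i)"

definition scramble_coord :: "nat \<Rightarrow> (nat list \<Rightarrow> nat \<Rightarrow> nat) \<Rightarrow> real \<Rightarrow> real" where
  "scramble_coord b \<sigma> x = (\<Sum>i. real (scramble_digit b \<sigma> x (Suc i)) / real b ^ Suc i)"

definition scramble_point ::
    "nat \<Rightarrow> ('s \<Rightarrow> nat list \<Rightarrow> nat \<Rightarrow> nat) \<Rightarrow> real ^ 's \<Rightarrow> real ^ 's" where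
  "scramble_point b \<sigma> u = (\<chi> j. scramble_coord b (\<sigma> j) (u $ j))"

abbreviation digit_perms :: "nat \<Rightarrow> (nat \<Rightarrow> nat) set" where
  "digit_perms b \<equiv> {p. p permutes {..<b}}"

text \<open>\<open>\<pi> j w\<close> is the random permutation for coordinate \<open>j\<close> and digit string \<open>w\<close>; the empty string
  gives the permutation of the first digit.\<close>

definition nested_uniform_perms ::
    "'w measure \<Rightarrow> nat \<Rightarrow> ('s \<Rightarrow> nat list \<Rightarrow> 'w \<Rightarrow> nat \<Rightarrow> nat) \<Rightarrow> bool" where
  "nested_uniform_perms M b \<pi> \<longleftrightarrow>
     prob_space M \<and>
     prob_space.indep_vars M (\<lambda>_. count_space (digit_perms b)) (\<lambda>(j, w). \<pi> j w)
       (UNIV \<times> lists {..<b}) \<and>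
     (\<forall>j. \<forall>w\<in>lists {..<b}.
        distr M (count_space (digit_perms b)) (\<pi> j w) = uniform_count_measure (digit_perms b))"

text \<open>The estimator \<open>(1/n) \<Sum>\<^sub>i 1\<^sub>A(U\<^sub>i)\<close>, as a function of one realisation \<open>\<sigma>\<close> of all the
  permutations. The sum runs over the original points, so that coinciding scrambled points would be
  counted with multiplicity.\<close>

definition scrambled_estimate ::
    "nat \<Rightarrow> (real ^ 's) set \<Rightarrow> (real ^ 's) set \<Rightarrow> ('s \<Rightarrow> nat list \<Rightarrow> nat \<Rightarrow> nat) \<Rightarrow> real" where
  "scrambled_estimate b P A \<sigma> =
     (\<Sum>u\<in>P. indicator A (scramble_point b \<sigma> u)) / real (card P)"

end

theory Submission
  imports Defs
begin

text \<open>Every scrambled point is uniform, so the claim says that the sum of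
  \<open>P(U\<^sub>u \<in> A, U\<^sub>v \<in> A)\<close> over ordered pairs \<open>u \<noteq> v\<close> is at most \<open>n (n - 1) \<mu>\<^sup>2\<close>. Enclose the box in one
  whose sides are unions of cells of length \<open>b\<^sup>-\<^sup>K\<close>. If \<open>u\<close> and \<open>v\<close> share exactly \<open>l\<^sub>j\<close> digits in coordinate
  \<open>j\<close>, the probability factors as \<open>\<Prod>\<^sub>j \<phi>\<^sub>j(l\<^sub>j)\<close>, and the net property makes the number of pairs sharing
  at least \<open>k\<^sub>j\<close> digits equal to \<open>n (b ^ (m - \<Sum>k\<^sub>j) - 1)\<close> (truncated subtraction). Summation by parts turns the claim into an
  inequality for the weights \<open>c\<^sub>j(k) = (\<phi>\<^sub>j(k) - \<phi>\<^sub>j(k - 1)) / b ^ k\<close>, which is trivial when all of them are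
  nonnegative. For a general interval at most one weight is negative, and only mildly so. Adding the
  coordinates one at a time, the remaining tail stays decreasing up to a constant factor \<open>1 / r\<close>, where each coordinate
  lowers \<open>r\<close> by \<open>1 / (b - 1)\<close>; starting from \<open>r = 1\<close> this can be afforded exactly \<open>b - 1\<close> times, and the last
  coordinate is handled by nonnegativity. This is where \<open>s \<le> b\<close> enters.\<close>

subsection \<open>Weighted counts and nonnegative tails\<close>

text \<open>A weight is negative when an extra common digit makes a joint hit less likely, as for an
  interval straddling a cell boundary, where many of its pairs separate. Products of such weights
  have no fixed sign, so level vectors cannot be compared one by one. Summation by parts groups them
  by total level: the sum of \<open>b ^ x * T x\<close> over \<open>x = 1..m\<close> must be
  nonnegative, where \<open>T x\<close> is the signed mass of the vectors with total at least
  \<open>x\<close>, and each coordinate convolves \<open>T\<close> with its weights. A weight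
  \<open>- e\<close> at \<open>i\<close> reads \<open>T (x - i)\<close>, while later weights read
  \<open>T\<close> at smaller arguments; if \<open>T\<close> is almost decreasing they cover the
  loss. As \<open>e\<close> is at most a \<open>(b - 1)\<close>th part of their sum, the price is
  \<open>1 / (b - 1)\<close>.

  That bound on \<open>e\<close> comes from counting pairs of integers in \<open>{p..<q}\<close> by
  common digits: the cell in which the ends separate has at most two cut subcells, finer cells have
  at most one. In the last coordinate only the weighted sum over \<open>x\<close> has to be
  nonnegative, and consecutive levels compensate each other. Enclosing boxes suffice for the pairs,
  where an upper bound is wanted; the exact mean is squeezed between inner and outer boxes.\<close>

definition almost_decreasing :: "real \<Rightarrow> (nat \<Rightarrow> real) \<Rightarrow> bool" where
  "almost_decreasing r V \<longleftrightarrow> (\<forall>x. 0 \<le> V x) \<and> (\<forall>x y. x \<le> y \<longrightarrow> r * V y \<le> V x)"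

text \<open>For the weights of an interval, the exceptional index \<open>i\<close> is the first digit level at which its
  two end points lie in different cells; beyond that level every cell is cut at most once.\<close>

definition admissible_weights :: "nat \<Rightarrow> nat \<Rightarrow> (nat \<Rightarrow> real) \<Rightarrow> bool" where
  "admissible_weights b K c \<longleftrightarrow>
     (\<exists>i. 1 \<le> i \<and> i \<le> K \<and> (\<forall>k\<le>K. k \<noteq> i \<longrightarrow> 0 \<le> c k) \<and>
          - c i * (real b - 1) \<le> (\<Sum>k\<in>{i<..K}. c k) \<and> 0 \<le> c (i - 1) + real b * c i)"

text \<open>A convolution. The truncated subtraction is deliberate: for a tail function,
  \<open>V 0\<close> is the whole mass, which is also the tail from any negative level.\<close>

definition smear :: "nat \<Rightarrow> (nat \<Rightarrow> real) \<Rightarrow> (nat \<Rightarrow> real) \<Rightarrow> nat \<Rightarrow> real" where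
  "smear K c V x = (\<Sum>k\<le>K. c k * V (x - k))"

lemma smear_split:
  assumes "i \<le> K"
  shows "smear K c V x = c i * V (x - i) + (\<Sum>k\<in>{..K} - {i}. c k * V (x - k))"
  unfolding smear_def using assms by (simp add: sum.remove)

text \<open>The only possible loss is \<open>e * V (x - i)\<close> with \<open>e = - c i\<close>.
  For \<open>k > i\<close> the argument \<open>x - k\<close> is smaller, so
  \<open>r * V (x - i) \<le> V (x - k)\<close>, and the weights beyond \<open>i\<close> sum to at
  least \<open>(b - 1) * e\<close>. Hence \<open>r\<close> times the loss is at most the fraction
  \<open>1 / (b - 1)\<close> of the nonnegative part \<open>P\<close>.\<close>

lemma almost_decreasing_smear:
  assumes b: "b \<ge> 2" and c: "admissible_weights b K c"
    and V: "almost_decreasing r V" and r: "1 / (real b - 1) \<le> r"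
  shows "almost_decreasing (r - 1 / (real b - 1)) (smear K c V)"
proof -
  define \<epsilon> where "\<epsilon> = 1 / (real b - 1)"
  have eps: "\<epsilon> > 0" "\<epsilon> * (real b - 1) = 1" using b by (auto simp: \<epsilon>_def)
  have rpos: "r > 0" using eps(1) r unfolding \<epsilon>_def by linarith
  have V0: "0 \<le> V x" for x using V by (simp add: almost_decreasing_def)
  have Vr: "r * V y \<le> V x" if "x \<le> y" for x y using V that by (simp add: almost_decreasing_def)
  obtain i where i: "1 \<le> i" "i \<le> K" and cpos: "\<And>k. k \<le> K \<Longrightarrow> k \<noteq> i \<Longrightarrow> 0 \<le> c k"
    and ci: "- c i * (real b - 1) \<le> (\<Sum>k\<in>{i<..K}. c k)"
    using c by (auto simp: admissible_weights_def)
  define P where "P x = (\<Sum>k\<in>{..K} - {i}. c k * V (x - k))" for x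
  have W: "smear K c V x = c i * V (x - i) + P x" for x
    unfolding P_def by (rule smear_split) fact
  have P0: "0 \<le> P x" for x unfolding P_def by (intro sum_nonneg mult_nonneg_nonneg cpos V0) auto
  have Pr: "r * P y \<le> P x" if "x \<le> y" for x y
  proof -
    have "r * P y = (\<Sum>k\<in>{..K} - {i}. c k * (r * V (y - k)))"
      unfolding P_def by (simp add: sum_distrib_left mult_ac)
    also have "\<dots> \<le> P x" unfolding P_def
      by (intro sum_mono mult_left_mono Vr cpos) (use that in auto)
    finally show ?thesis .
  qed
  show ?thesis
  proof (cases "c i \<ge> 0")
    case True
    have "0 \<le> smear K c V x" for x using True V0 P0 by (simp add: W)
    moreover have "(r - \<epsilon>) * smear K c V y \<le> smear K c V x" if "x \<le> y" for x y
    proof -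
      have "c i * (r * V (y - i)) \<le> c i * V (x - i)"
        by (intro mult_left_mono Vr) (use that True in auto)
      then have "r * smear K c V y \<le> smear K c V x"
        using Pr[OF that] by (simp add: W algebra_simps)
      moreover have "\<epsilon> * smear K c V y \<ge> 0" using eps True V0 P0 by (simp add: W)
      ultimately show ?thesis by (simp add: algebra_simps)
    qed
    ultimately show ?thesis by (simp add: almost_decreasing_def \<epsilon>_def)
  next
    case False
    define e where "e = - c i"
    have e: "e \<ge> 0" using False by (simp add: e_def)
    have key: "r * (e * V (x - i)) \<le> \<epsilon> * P x" for x
    proof -
      have "(real b - 1) * (r * (e * V (x - i))) = (e * (real b - 1)) * (r * V (x - i))" by simp
      also have "\<dots> \<le> (\<Sum>k\<in>{i<..K}. c k) * (r * V (x - i))"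
        by (intro mult_right_mono) (use ci V0 rpos in \<open>auto simp: e_def\<close>)
      also have "\<dots> = (\<Sum>k\<in>{i<..K}. c k * (r * V (x - i)))" by (simp add: sum_distrib_right)
      also have "\<dots> \<le> (\<Sum>k\<in>{i<..K}. c k * V (x - k))"
        by (intro sum_mono mult_left_mono Vr cpos) auto
      also have "\<dots> \<le> P x" unfolding P_def
        by (intro sum_mono2) (auto intro!: mult_nonneg_nonneg cpos V0)
      finally have "\<epsilon> * ((real b - 1) * (r * (e * V (x - i)))) \<le> \<epsilon> * P x"
        using eps by (intro mult_left_mono) auto
      then show ?thesis using eps(2) by (simp add: mult.assoc[symmetric])
    qed
    have W': "smear K c V x = P x - e * V (x - i)" for x by (simp add: W e_def)
    have low: "(r - \<epsilon>) * P x \<le> r * smear K c V x" for x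
      using key[of x] by (simp add: W' algebra_simps)
    have reps: "r - \<epsilon> \<ge> 0" using r by (simp add: \<epsilon>_def)
    have "0 \<le> smear K c V x" for x
      using low[of x] reps P0[of x] rpos
      by (meson mult_nonneg_nonneg order_trans zero_le_mult_iff less_le_not_le)
    moreover have "(r - \<epsilon>) * smear K c V y \<le> smear K c V x" if "x \<le> y" for x y
    proof -
      have "r * ((r - \<epsilon>) * smear K c V y) \<le> r * ((r - \<epsilon>) * P y)"
        by (intro mult_left_mono) (use W' e V0 reps rpos in auto)
      also have "\<dots> = (r - \<epsilon>) * (r * P y)" by simp
      also have "\<dots> \<le> (r - \<epsilon>) * P x" by (intro mult_left_mono Pr that reps)
      also have "\<dots> \<le> r * smear K c V x" by (rule low)
      finally show ?thesis using rpos by simp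
    qed
    ultimately show ?thesis by (simp add: almost_decreasing_def \<epsilon>_def)
  qed
qed

text \<open>The last of the \<open>s \<le> b\<close> smearings may start from an exhausted constant \<open>r = 0\<close>: here
  nonnegativity alone suffices, since the negative weight at \<open>i\<close> is absorbed after a shift by one.\<close>

lemma weighted_sum_smear_nonneg:
  assumes b: "b \<ge> 2" and c: "admissible_weights b K c" and V0: "\<And>x. 0 \<le> V x"
  shows "0 \<le> (\<Sum>x=1..m. real b ^ x * smear K c V x)"
proof -
  obtain i where i: "1 \<le> i" "i \<le> K" and cpos: "\<And>k. k \<le> K \<Longrightarrow> k \<noteq> i \<Longrightarrow> 0 \<le> c k"
    and ci: "- c i * (real b - 1) \<le> (\<Sum>k\<in>{i<..K}. c k)"
    and ci': "0 \<le> c (i - 1) + real b * c i"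
    using c by (auto simp: admissible_weights_def)
  have tail0: "0 \<le> (\<Sum>k\<in>{i<..K}. c k)" by (intro sum_nonneg cpos) auto
  have tail: "0 \<le> c i + (\<Sum>k\<in>{i<..K}. c k)"
  proof (cases "c i \<ge> 0")
    case False
    then have "- c i * 1 \<le> - c i * (real b - 1)" using b by (intro mult_left_mono) auto
    then show ?thesis using ci by simp
  qed (use tail0 in simp)
  \<comment> \<open>The invariant keeps the term of weight \<open>c (i - 1)\<close> at the top level
    in reserve. One level up it pays for the negative \<open>c i\<close>: both read \<open>V\<close>
    at \<open>m - (i - 1) = Suc m - i\<close>, and the factor grows by \<open>b\<close>. For
    \<open>m = 0\<close> there is no reserve yet.\<close>
  have bound: "(\<Sum>x=1..m. real b ^ x * smear K c V x) \<ge>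
      (if m = 0 then 0 else real b ^ m * c (i - 1) * V (m - (i - 1)))" for m
  proof (induction m)
    case (Suc m)
    let ?x = "Suc m"
    have sub: "smear K c V ?x \<ge> c (i - 1) * V (?x - (i - 1)) + c i * V (?x - i) +
        (\<Sum>k\<in>{i<..K}. c k * V (?x - k))"
    proof -
      have "(\<Sum>k\<in>{..K} - {i}. c k * V (?x - k)) \<ge> (\<Sum>k\<in>insert (i - 1) {i<..K}. c k * V (?x - k))"
        by (intro sum_mono2) (use i in \<open>auto intro!: mult_nonneg_nonneg cpos V0\<close>)
      also have "(\<Sum>k\<in>insert (i - 1) {i<..K}. c k * V (?x - k)) =
          c (i - 1) * V (?x - (i - 1)) + (\<Sum>k\<in>{i<..K}. c k * V (?x - k))"
        using i by (subst sum.insert) auto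
      finally show ?thesis by (subst smear_split[OF i(2)]) linarith
    qed
    have tn: "0 \<le> (\<Sum>k\<in>{i<..K}. c k * V (?x - k))"
      by (intro sum_nonneg mult_nonneg_nonneg cpos V0) auto
    have "0 \<le> real b ^ ?x * (c i * V (?x - i) + (\<Sum>k\<in>{i<..K}. c k * V (?x - k))) +
        (if m = 0 then 0 else real b ^ m * c (i - 1) * V (m - (i - 1)))"
    proof (cases "?x \<le> i")
      \<comment> \<open>All arguments are truncated to 0, so only the sum of the weights from
        \<open>i\<close> on matters. As \<open>1 \<le> i\<close>, the start \<open>m = 0\<close>
        always falls into this case.\<close>
      case True
      have "(\<Sum>k\<in>{i<..K}. c k * V (?x - k)) = (\<Sum>k\<in>{i<..K}. c k) * V 0"
        unfolding sum_distrib_right by (intro sum.cong) (use True in auto)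
      then have "c i * V (?x - i) + (\<Sum>k\<in>{i<..K}. c k * V (?x - k)) =
          (c i + (\<Sum>k\<in>{i<..K}. c k)) * V 0" using True by (simp add: algebra_simps)
      then have "0 \<le> c i * V (?x - i) + (\<Sum>k\<in>{i<..K}. c k * V (?x - k))"
        using tail V0 by simp
      then show ?thesis using cpos[of "i - 1"] i V0 by simp
    next
      case False
      then have m: "m \<noteq> 0" "m - (i - 1) = ?x - i" using i by auto
      have "0 \<le> real b ^ m * ((c (i - 1) + real b * c i) * V (?x - i))"
        using ci' V0 by simp
      also have "\<dots> = real b ^ ?x * (c i * V (?x - i)) + real b ^ m * c (i - 1) * V (m - (i - 1))"
        unfolding m(2) by (simp add: algebra_simps)
      finally show ?thesis
        using mult_nonneg_nonneg[OF _ tn, of "real b ^ ?x"] m(1) by (simp add: distrib_left)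
    qed
    moreover have "real b ^ ?x * smear K c V ?x \<ge> real b ^ ?x * (c (i - 1) * V (?x - (i - 1)) +
        c i * V (?x - i) + (\<Sum>k\<in>{i<..K}. c k * V (?x - k)))"
      by (intro mult_left_mono sub) simp
    ultimately show ?case using Suc.IH by (simp add: algebra_simps split: if_splits)
  qed simp
  have "0 \<le> (if m = 0 then 0 else real b ^ m * c (i - 1) * V (m - (i - 1)))"
    using cpos[of "i - 1"] i V0 by simp
  then show ?thesis using bound[of m] by linarith
qed

text \<open>The signed mass of the level vectors on \<open>J\<close> with total at least
  \<open>x\<close>, written as the whole mass minus the part below \<open>x\<close>.\<close>

definition tail_weight :: "nat \<Rightarrow> ('s \<Rightarrow> nat \<Rightarrow> real) \<Rightarrow> 's set \<Rightarrow> nat \<Rightarrow> real" where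
  "tail_weight K c J x =
     (\<Prod>j\<in>J. \<Sum>k\<le>K. c j k) -
     (\<Sum>k\<in>PiE J (\<lambda>_. {..K}). if (\<Sum>j\<in>J. k j) < x then \<Prod>j\<in>J. c j (k j) else 0)"

text \<open>Split off the entry \<open>a\<close> at \<open>j\<close>: the total is below
  \<open>x\<close> iff the rest is below \<open>x - a\<close>. With truncated subtraction this stays
  true for \<open>a \<ge> x\<close>, since nothing is below 0.\<close>

lemma tail_weight_insert:
  assumes J: "finite J" "j \<notin> J"
  shows "tail_weight K c (insert j J) = smear K (c j) (tail_weight K c J)"
proof
  fix x
  let ?F = "PiE J (\<lambda>_. {..K})"
  have inj: "inj_on (\<lambda>(y, g). g(j := y)) ({..K} \<times> ?F)"
    using J(2) by (rule inj_combinator)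
  have eq: "(\<Sum>i\<in>insert j J. (k(j := a)) i) = a + (\<Sum>i\<in>J. k i)"
    "(\<Prod>i\<in>insert j J. c i ((k(j := a)) i)) = c j a * (\<Prod>i\<in>J. c i (k i))" for k a
  proof -
    have "(\<Sum>i\<in>J. (k(j := a)) i) = (\<Sum>i\<in>J. k i)" by (intro sum.cong) (use J in auto)
    then show "(\<Sum>i\<in>insert j J. (k(j := a)) i) = a + (\<Sum>i\<in>J. k i)" using J by simp
    have "(\<Prod>i\<in>J. c i ((k(j := a)) i)) = (\<Prod>i\<in>J. c i (k i))" by (intro prod.cong) (use J in auto)
    then show "(\<Prod>i\<in>insert j J. c i ((k(j := a)) i)) = c j a * (\<Prod>i\<in>J. c i (k i))" using J by simp
  qed
  have "(\<Sum>k\<in>PiE (insert j J) (\<lambda>_. {..K}).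
          if (\<Sum>i\<in>insert j J. k i) < x then \<Prod>i\<in>insert j J. c i (k i) else 0) =
        (\<Sum>(a, k)\<in>{..K} \<times> ?F. if a + (\<Sum>i\<in>J. k i) < x then c j a * (\<Prod>i\<in>J. c i (k i)) else 0)"
    unfolding PiE_insert_eq sum.reindex[OF inj] unfolding o_def case_prod_unfold eq ..
  also have "\<dots> = (\<Sum>a\<le>K. c j a * (\<Sum>k\<in>?F. if (\<Sum>i\<in>J. k i) < x - a then \<Prod>i\<in>J. c i (k i) else 0))"
    unfolding sum.cartesian_product[symmetric] sum_distrib_left
    by (intro sum.cong refl) auto
  finally show "tail_weight K c (insert j J) x = smear K (c j) (tail_weight K c J) x"
    using J unfolding tail_weight_def smear_def
    by (simp add: sum_distrib_right sum_subtractf right_diff_distrib)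
qed

text \<open>For empty \<open>J\<close> the tail is the indicator of \<open>x = 0\<close>, which
  gives \<open>r = 1\<close>. The condition \<open>card J < b\<close> ensures that \<open>r\<close>
  is still at least \<open>1 / (b - 1)\<close> before each further smearing.\<close>

lemma almost_decreasing_tail_weight:
  assumes b: "b \<ge> 2" and c: "\<And>j. j \<in> J \<Longrightarrow> admissible_weights b K (c j)"
    and "finite J" "card J < b"
  shows "almost_decreasing (1 - card J / (real b - 1)) (tail_weight K c J)"
  using assms(3) c assms(4)
proof (induction J)
  case empty
  have "(\<Sum>k\<in>PiE {} (\<lambda>_. {..K}). if (\<Sum>j\<in>{}. k j) < x then \<Prod>j\<in>{}. c j (k j) else 0) =
      (if x = 0 then 0 else 1)" for x
    by (simp add: PiE_empty_domain)
  then show ?case by (simp add: almost_decreasing_def tail_weight_def)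
next
  case (insert j J)
  have "almost_decreasing (1 - card J / (real b - 1) - 1 / (real b - 1)) (smear K (c j) (tail_weight K c J))"
    by (rule almost_decreasing_smear) (use insert b in \<open>auto simp: field_simps\<close>)
  also have "1 - card J / (real b - 1) - 1 / (real b - 1) = 1 - card (insert j J) / (real b - 1)"
    using insert by (simp add: diff_diff_eq add_divide_distrib[symmetric] add.commute)
  finally show ?case using insert by (simp add: tail_weight_insert)
qed

text \<open>A vector of total \<open>r \<le> m\<close> carries the factor
  \<open>b ^ m - b ^ r\<close>, a geometric sum over the levels \<open>r < x \<le> m\<close>.
  Exchanging the sums shows that right side minus left side is \<open>(b - 1) / b\<close> times the
  sum of \<open>b ^ x * tail_weight K c UNIV x\<close>.\<close>

lemma net_weighted_sum_le:
  fixes c :: "'s::finite \<Rightarrow> nat \<Rightarrow> real"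
  assumes b: "b \<ge> 2" "CARD('s) \<le> b" and c: "\<And>j. admissible_weights b K (c j)"
  shows "(\<Sum>k\<in>PiE UNIV (\<lambda>_. {..K}).
            (\<Prod>j\<in>UNIV. c j (k j)) * (real b ^ (\<Sum>j\<in>UNIV. k j) * (real b ^ (m - (\<Sum>j\<in>UNIV. k j)) - 1)))
         \<le> (real b ^ m - 1) * (\<Prod>j\<in>UNIV. \<Sum>k\<le>K. c j k)"
proof -
  obtain j0 :: 's where True by auto
  define J where "J = - {j0}"
  have U: "UNIV = insert j0 J" "j0 \<notin> J" by (auto simp: J_def)
  have cardJ: "card J < b" using b U by (metis card_insert_disjoint finite_code Suc_le_lessD)
  have "almost_decreasing (1 - card J / (real b - 1)) (tail_weight K c J)"
    by (rule almost_decreasing_tail_weight) (use b c cardJ in auto)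
  then have V0: "0 \<le> tail_weight K c J x" for x by (simp add: almost_decreasing_def)
  have nn: "0 \<le> (\<Sum>x=1..m. real b ^ x * tail_weight K c UNIV x)"
    unfolding U(1) tail_weight_insert[OF _ U(2), simplified]
    by (rule weighted_sum_smear_nonneg[OF b(1) c V0])
  have geo: "(real b - 1) * (\<Sum>x=1..m. if r < x then real b ^ x else 0) =
      real b * (real b ^ r * (real b ^ (m - r) - 1))" for r
  proof (induction m)
    case (Suc m)
    show ?case
    proof (cases "r \<le> m")
      case True
      then obtain d where "m = r + d" using le_Suc_ex by blast
      then show ?thesis using Suc by (simp add: algebra_simps power_add)
    next
      case False
      then show ?thesis using Suc by simp
    qed
  qed simp
  let ?F = "PiE UNIV (\<lambda>_. {..K}) :: ('s \<Rightarrow> nat) set"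
  let ?G = "\<Prod>j\<in>UNIV. \<Sum>k\<le>K. c j k"
  let ?s = "\<lambda>k. \<Sum>j\<in>UNIV. k j :: nat"
  let ?p = "\<lambda>k. \<Prod>j\<in>UNIV. c j (k j)"
  have "real b * (\<Sum>k\<in>?F. ?p k * (real b ^ ?s k * (real b ^ (m - ?s k) - 1))) =
     (\<Sum>k\<in>?F. ?p k * ((real b - 1) * (\<Sum>x=1..m. if ?s k < x then real b ^ x else 0)))"
    unfolding geo by (simp add: sum_distrib_left mult_ac)
  also have "\<dots> = (real b - 1) * (\<Sum>k\<in>?F. \<Sum>x=1..m. real b ^ x * (if ?s k < x then ?p k else 0))"
    unfolding sum_distrib_left by (intro sum.cong refl) auto
  also have "\<dots> = (real b - 1) * (\<Sum>x=1..m. real b ^ x * (\<Sum>k\<in>?F. if ?s k < x then ?p k else 0))"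
    by (subst sum.swap) (simp add: sum_distrib_left)
  also have "\<dots> = (real b - 1) * (\<Sum>x=1..m. real b ^ x * (?G - tail_weight K c UNIV x))"
    by (simp add: tail_weight_def)
  also have "\<dots> = (real b - 1) * ((\<Sum>x=1..m. real b ^ x) * ?G) -
      (real b - 1) * (\<Sum>x=1..m. real b ^ x * tail_weight K c UNIV x)"
    by (simp add: right_diff_distrib sum_subtractf sum_distrib_right)
  also have "\<dots> \<le> ((real b - 1) * (\<Sum>x=1..m. real b ^ x)) * ?G"
    using nn b by (simp add: mult.assoc)
  also have "(real b - 1) * (\<Sum>x=1..m. real b ^ x) = real b * (real b ^ m - 1)"
    using geo[of 0] by simp
  finally show ?thesis using b by (simp add: mult.assoc)
qed

subsection \<open>Weights of an interval\<close>

text \<open>The number of ordered pairs from two different classes, if class \<open>i\<close> has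
  \<open>x i\<close> elements.\<close>

definition cross_sum :: "nat \<Rightarrow> (nat \<Rightarrow> real) \<Rightarrow> real" where
  "cross_sum b x = (\<Sum>i<b. x i)\<^sup>2 - (\<Sum>i<b. (x i)\<^sup>2)"

lemma cross_sum_nonneg:
  assumes "\<And>i. i < b \<Longrightarrow> 0 \<le> x i"
  shows "0 \<le> cross_sum b x"
  using assms
proof (induction b)
  case (Suc b)
  have "cross_sum (Suc b) x = cross_sum b x + 2 * (\<Sum>i<b. x i) * x b"
    by (simp add: cross_sum_def power2_sum)
  moreover have "0 \<le> (\<Sum>i<b. x i)" by (intro sum_nonneg) (use Suc in auto)
  ultimately show ?case using Suc by simp
qed (simp add: cross_sum_def)

text \<open>Apply nonnegativity to the complementary counts \<open>M - x i\<close>.\<close>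

lemma cross_sum_ge:
  assumes "\<And>i. i < b \<Longrightarrow> x i \<le> M"
  shows "(real b - 1) * M * (2 * (\<Sum>i<b. x i) - real b * M) \<le> cross_sum b x"
proof -
  have "0 \<le> cross_sum b (\<lambda>i. M - x i)" by (intro cross_sum_nonneg) (use assms in auto)
  then show ?thesis
    by (simp add: cross_sum_def sum_subtractf sum.distrib power2_diff sum_distrib_left[symmetric]
        sum_distrib_right[symmetric] algebra_simps power2_eq_square)
qed

lemma sum_full_cells:
  fixes f :: "real \<Rightarrow> real"
  assumes "finite I" "\<And>i. i \<in> I \<Longrightarrow> x i = 0 \<or> x i = N" "f 0 = 0"
  shows "(\<Sum>i\<in>I. f (x i)) = real (card {i\<in>I. x i = N}) * f N"
proof -
  have "(\<Sum>i\<in>I. f (x i)) = (\<Sum>i\<in>I. if x i = N then f N else 0)"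
  proof (rule sum.cong)
    fix i assume "i \<in> I"
    from assms(2)[OF this] show "f (x i) = (if x i = N then f N else 0)" using assms(3) by auto
  qed simp
  then show ?thesis using assms(1) by (simp add: sum.If_cases Int_def conj_commute)
qed

text \<open>In the next two lemmas \<open>x i\<close> is the number of points in the \<open>i\<close>th subcell of a cell (each of size
  \<open>N\<close>), and \<open>e i\<close> stands for the cross sum of that subcell, bounded below by \<open>cross_sum_ge\<close>.\<close>

lemma cross_sum_one_partial:
  assumes b: "b \<ge> 2" and i0: "i0 < b" and N: "N = real b * M" "0 \<le> M"
    and x: "\<And>i. i < b \<Longrightarrow> i \<noteq> i0 \<Longrightarrow> x i = 0 \<or> x i = N"
    and x0: "0 \<le> x i0" "x i0 \<le> N"
    and e0: "\<And>i. i < b \<Longrightarrow> 0 \<le> e i"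
    and e: "\<And>i. i < b \<Longrightarrow> (real b - 1) * M * (2 * x i - N) \<le> e i"
  shows "cross_sum b x \<le> real b * (\<Sum>i<b. e i)"
proof -
  define I where "I = {..<b} - {i0}"
  define R where "R = {i\<in>I. x i = N}"
  define r where "r = real (card R)"
  define y where "y = x i0"
  have I: "finite I" "card I = b - 1" "{..<b} = insert i0 I" "i0 \<notin> I" using i0 by (auto simp: I_def)
  have "card R \<le> b - 1" unfolding I(2)[symmetric] R_def by (rule card_mono) (use I in auto)
  then have r: "0 \<le> r" "r \<le> real b - 1" using b by (auto simp: r_def)
  have xI: "x i = 0 \<or> x i = N" if "i \<in> I" for i using x that by (auto simp: I_def)
  have s: "(\<Sum>i<b. x i) = y + r * N" "(\<Sum>i<b. (x i)\<^sup>2) = y\<^sup>2 + r * N\<^sup>2"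
    using sum_full_cells[of I x N "\<lambda>z. z", OF I(1) xI] sum_full_cells[of I x N "\<lambda>z. z\<^sup>2", OF I(1) xI]
    unfolding I(3) using I(1,4) by (simp_all add: y_def r_def R_def)
  have cs: "cross_sum b x = r * (r - 1) * N\<^sup>2 + 2 * r * N * y"
    unfolding cross_sum_def s by (simp add: power2_eq_square algebra_simps)
  have "(\<Sum>i<b. e i) = e i0 + (\<Sum>i\<in>I. e i)" unfolding I(3) using I(1,4) by simp
  moreover have "(\<Sum>i\<in>R. e i) \<le> (\<Sum>i\<in>I. e i)"
    by (intro sum_mono2) (use I(1) e0 in \<open>auto simp: R_def I_def\<close>)
  moreover have "(\<Sum>i\<in>R. (real b - 1) * M * N) \<le> (\<Sum>i\<in>R. e i)"
  proof (rule sum_mono)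
    fix i assume "i \<in> R"
    then show "(real b - 1) * M * N \<le> e i" using e[of i] by (auto simp: R_def I_def)
  qed
  ultimately have "e i0 + r * ((real b - 1) * M * N) \<le> (\<Sum>i<b. e i)" by (simp add: r_def)
  then have "real b * (e i0 + r * ((real b - 1) * M * N)) \<le> real b * (\<Sum>i<b. e i)"
    by (rule mult_left_mono) simp
  then have es: "real b * e i0 + r * (real b - 1) * N\<^sup>2 \<le> real b * (\<Sum>i<b. e i)"
    by (simp add: N(1) algebra_simps power2_eq_square)
  have be0: "0 \<le> real b * e i0" using e0[OF i0] by simp
  have "real b * ((real b - 1) * M * (2 * y - N)) \<le> real b * e i0"
    unfolding y_def by (intro mult_left_mono e i0) simp
  then have be1: "(real b - 1) * N * (2 * y - N) \<le> real b * e i0"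
    by (simp add: N(1) algebra_simps)
  have N0: "0 \<le> N" using N by simp
  have y: "0 \<le> y" "y \<le> N" using x0 by (auto simp: y_def)
  \<comment> \<open>If \<open>y\<close> is at most half of \<open>N\<close>, the
    \<open>r \<le> b - 1\<close> full subcells alone suffice. Otherwise the lower bound on
    \<open>e i0\<close> pays for the excess \<open>2 * y - N\<close>.\<close>
  have "r * (r - 1) * N\<^sup>2 + 2 * r * N * y \<le> real b * e i0 + r * (real b - 1) * N\<^sup>2"
  proof (cases "2 * y \<le> N")
    case True
    have "r * N * (2 * y) \<le> r * N * N" by (intro mult_left_mono True) (use r N0 in auto)
    moreover have "r * (r - 1) * N\<^sup>2 + r * N * N \<le> r * (real b - 1) * N\<^sup>2"
    proof -
      have "0 \<le> r * (real b - 1 - r) * N\<^sup>2" using r by simp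
      then show ?thesis by (simp add: algebra_simps power2_eq_square)
    qed
    ultimately show ?thesis using be0 by (simp add: algebra_simps)
  next
    case False
    have "0 \<le> (real b - 1 - r) * N * (2 * y - N)" using r N0 False by simp
    moreover have "0 \<le> r * (real b - 1 - r) * N\<^sup>2" using r by simp
    ultimately show ?thesis using be1 by (simp add: algebra_simps power2_eq_square)
  qed
  then show ?thesis using cs es by linarith
qed

lemma cross_sum_two_partial:
  assumes i01: "i0 < b" "i1 < b" "i0 \<noteq> i1" and N: "N = real b * M" "0 \<le> M"
    and x: "\<And>i. i < b \<Longrightarrow> i \<noteq> i0 \<Longrightarrow> i \<noteq> i1 \<Longrightarrow> x i = 0 \<or> x i = N"
    and x01: "\<And>i. i < b \<Longrightarrow> 0 \<le> x i" "\<And>i. i < b \<Longrightarrow> x i \<le> N"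
    and e0: "\<And>i. i < b \<Longrightarrow> 0 \<le> e i"
    and e: "\<And>i. i < b \<Longrightarrow> (real b - 1) * M * (2 * x i - N) \<le> e i"
  shows "(real b - 1) * cross_sum b x \<le>
           (real b - 1) * (\<Sum>i<b. (x i)\<^sup>2) + real b * (real b - 2) * (\<Sum>i<b. e i)"
proof -
  define I where "I = {..<b} - {i0, i1}"
  define R where "R = {i\<in>I. x i = N}"
  define r where "r = real (card R)"
  define y where "y = x i0"
  define z where "z = x i1"
  have b: "b \<ge> 2" using i01 by linarith
  have I: "finite I" "card I = b - 2" "{..<b} = insert i0 (insert i1 I)" "i0 \<notin> I" "i1 \<notin> I"
    using i01 by (auto simp: I_def card_Diff_subset)
  have "card R \<le> b - 2" unfolding I(2)[symmetric] R_def by (rule card_mono) (use I in auto)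
  then have r: "0 \<le> r" "r \<le> real b - 2" using b by (auto simp: r_def)
  have xI: "x i = 0 \<or> x i = N" if "i \<in> I" for i using x that by (auto simp: I_def)
  have s: "(\<Sum>i<b. x i) = y + z + r * N" "(\<Sum>i<b. (x i)\<^sup>2) = y\<^sup>2 + z\<^sup>2 + r * N\<^sup>2"
    using sum_full_cells[of I x N "\<lambda>z. z", OF I(1) xI] sum_full_cells[of I x N "\<lambda>z. z\<^sup>2", OF I(1) xI]
    unfolding I(3) using I(1,4,5) i01 by (simp_all add: y_def z_def r_def R_def)
  have cs: "cross_sum b x = r * (r - 1) * N\<^sup>2 + 2 * r * N * y + 2 * r * N * z + 2 * y * z"
    unfolding cross_sum_def s by (simp add: power2_eq_square algebra_simps)
  have "(\<Sum>i<b. e i) = e i0 + e i1 + (\<Sum>i\<in>I. e i)" unfolding I(3) using I(1,4,5) i01 by simp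
  moreover have "(\<Sum>i\<in>R. e i) \<le> (\<Sum>i\<in>I. e i)"
    by (intro sum_mono2) (use I(1) e0 in \<open>auto simp: R_def I_def\<close>)
  moreover have "(\<Sum>i\<in>R. (real b - 1) * M * N) \<le> (\<Sum>i\<in>R. e i)"
  proof (rule sum_mono)
    fix i assume "i \<in> R"
    then show "(real b - 1) * M * N \<le> e i" using e[of i] by (auto simp: R_def I_def)
  qed
  ultimately have "e i0 + e i1 + r * ((real b - 1) * M * N) \<le> (\<Sum>i<b. e i)" by (simp add: r_def)
  then have "real b * (real b - 2) * (e i0 + e i1 + r * ((real b - 1) * M * N)) \<le>
      real b * (real b - 2) * (\<Sum>i<b. e i)"
    by (rule mult_left_mono) (use b in simp)
  then have es: "real b * (real b - 2) * e i0 + real b * (real b - 2) * e i1 +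
      (real b - 1) * ((real b - 2) * r * N\<^sup>2) \<le> real b * (real b - 2) * (\<Sum>i<b. e i)"
    by (simp add: N(1) algebra_simps power2_eq_square)
  have N0: "0 \<le> N" using N by simp
  \<comment> \<open>Among themselves the full subcells leave a surplus
    \<open>r * (b - r) * N\<^sup>2\<close>, up to the common factor \<open>b - 1\<close>. Half of it
    is assigned to each of the two partial subcells. Their mixed product \<open>2 * y * z\<close> is
    absorbed by \<open>y\<^sup>2 + z\<^sup>2\<close>.\<close>
  have part: "(real b - 1) * (2 * r * N * u - r * (real b - r) * N\<^sup>2 / 2) \<le> real b * (real b - 2) * e i"
    if u: "u = x i" and i: "i < b" for u i
  proof (cases "2 * u \<le> N")
    case True
    have "r * N * (2 * u) \<le> r * N * N" by (intro mult_left_mono True) (use r N0 in auto)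
    moreover have "0 \<le> r * (real b - 2 - r) * N\<^sup>2" using r by simp
    ultimately have "2 * r * N * u - r * (real b - r) * N\<^sup>2 / 2 \<le> 0"
      by (simp add: algebra_simps power2_eq_square)
    then have "(real b - 1) * (2 * r * N * u - r * (real b - r) * N\<^sup>2 / 2) \<le> 0"
      using b by (intro mult_nonneg_nonpos) auto
    also have "0 \<le> real b * (real b - 2) * e i" using b e0[OF i] by simp
    finally show ?thesis .
  next
    case False
    have "0 \<le> (real b - 2 - r) * N * (2 * u - N)" using r N0 False by simp
    moreover have "0 \<le> r * (real b - 2 - r) * N\<^sup>2" using r by simp
    ultimately have "2 * r * N * u - r * (real b - r) * N\<^sup>2 / 2 \<le> (real b - 2) * N * (2 * u - N)"
      by (simp add: algebra_simps power2_eq_square diff_divide_distrib)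
    then have "(real b - 1) * (2 * r * N * u - r * (real b - r) * N\<^sup>2 / 2) \<le>
        (real b - 1) * ((real b - 2) * N * (2 * u - N))"
      by (rule mult_left_mono) (use b in simp)
    also have "\<dots> = real b * (real b - 2) * ((real b - 1) * M * (2 * x i - N))"
      by (simp add: N(1) u)
    also have "\<dots> \<le> real b * (real b - 2) * e i"
      by (intro mult_left_mono e i) (use b in auto)
    finally show ?thesis .
  qed
  have "0 \<le> (real b - 1) * (y - z)\<^sup>2" using b by simp
  moreover have "(real b - 1) * cross_sum b x =
      (real b - 1) * (y\<^sup>2 + z\<^sup>2 + r * N\<^sup>2) + (real b - 1) * ((real b - 2) * r * N\<^sup>2) +
      (real b - 1) * (2 * r * N * y - r * (real b - r) * N\<^sup>2 / 2) +
      (real b - 1) * (2 * r * N * z - r * (real b - r) * N\<^sup>2 / 2) - (real b - 1) * (y - z)\<^sup>2"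
    unfolding cs by (simp add: field_simps power2_eq_square)
  ultimately show ?thesis
    using es part[OF y_def i01(1)] part[OF z_def i01(2)] unfolding s by linarith
qed

section \<open>Integers of an interval, counted by cells and by common digits\<close>

definition cell_count :: "nat \<Rightarrow> nat \<Rightarrow> nat \<Rightarrow> nat \<Rightarrow> real" where
  "cell_count p q M c = real (card {z \<in> {p..<q}. z div M = c})"

lemma div_eq_iff_cell: "0 < M \<Longrightarrow> z div M = c \<longleftrightarrow> z \<in> {c * M..<Suc c * M}" for c :: nat
proof
  assume "z \<in> {c * M..<Suc c * M}"
  then show "z div M = c" by (intro div_nat_eqI) (auto simp: mult.commute)
next
  assume "0 < M" "z div M = c"
  then show "z \<in> {c * M..<Suc c * M}"
    using div_times_less_eq_dividend[of z M] dividend_less_div_times[of M z] by auto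
qed

lemma cell_count_nonneg: "0 \<le> cell_count p q M c"
  by (simp add: cell_count_def)

lemma cell_count_le:
  assumes "0 < M"
  shows "cell_count p q M c \<le> real M"
proof -
  have "card {z \<in> {p..<q}. z div M = c} \<le> card {c * M..<Suc c * M}"
    unfolding div_eq_iff_cell[OF assms] by (intro card_mono subsetI) blast+
  then show ?thesis by (simp add: cell_count_def)
qed

text \<open>A cell that is met but not filled must contain an end element of the interval, the first
  one \<open>p\<close> or the last one \<open>q - 1\<close>.\<close>

lemma cell_count_uncut:
  assumes M: "0 < M" and "c \<noteq> p div M" "c \<noteq> (q - 1) div M"
  shows "cell_count p q M c = 0 \<or> cell_count p q M c = real M"
proof -
  have a: "p \<notin> {c * M..<Suc c * M}" "q - 1 \<notin> {c * M..<Suc c * M}"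
    unfolding div_eq_iff_cell[OF M, symmetric] using assms by auto
  have C: "{z \<in> {p..<q}. z div M = c} = {p..<q} \<inter> {c * M..<Suc c * M}"
    unfolding div_eq_iff_cell[OF M] by blast
  define l where "l = c * M"
  define u where "u = Suc c * M"
  have lu: "u = l + M" by (simp add: l_def u_def)
  have "{p..<q} \<inter> {l..<u} = {} \<or> {p..<q} \<inter> {l..<u} = {l..<u}"
    using a[folded l_def u_def] by fastforce
  then have "card ({p..<q} \<inter> {l..<u}) = 0 \<or> card ({p..<q} \<inter> {l..<u}) = M"
    unfolding lu by (metis card.empty card_atLeastLessThan diff_add_inverse)
  then show ?thesis unfolding cell_count_def C l_def u_def by linarith
qed

lemma div_cell_split: "i < b \<Longrightarrow> z div M = b * c + i \<Longrightarrow> z div (b * M) = (c::nat)"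
  by (simp add: mult.commute[of b M] div_mult2_eq)

lemma cell_count_split:
  assumes b: "0 < b"
  shows "cell_count p q (b * M) c = (\<Sum>i<b. cell_count p q M (b * c + i))"
proof -
  have "{z \<in> {p..<q}. z div (b * M) = c} = (\<Union>i<b. {z \<in> {p..<q}. z div M = b * c + i})" (is "?l = ?r")
  proof (intro equalityI subsetI)
    fix z assume z: "z \<in> ?l"
    then have "z div M div b = c" by (simp add: div_mult2_eq mult.commute[of b])
    then have "z div M = b * c + z div M mod b" by (metis mult_div_mod_eq)
    moreover have "z div M mod b < b" using b by simp
    ultimately show "z \<in> ?r" using z by blast
  qed (use div_cell_split in blast)
  also have "card \<dots> = (\<Sum>i<b. card {z \<in> {p..<q}. z div M = b * c + i})"
    by (rule card_UN_disjoint) auto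
  finally show ?thesis by (simp add: cell_count_def)
qed

lemma sum_lessThan_mult: "(\<Sum>c<n. \<Sum>i<b. f (b * c + i)) = (\<Sum>c<b * n. f c)" for f :: "nat \<Rightarrow> real"
proof -
  have "(\<Sum>i<b. f (b * c + i)) = sum f {c * b..<c * b + b}" for c
    using sum.shift_bounds_nat_ivl[of f 0 "c * b" b] by (simp add: lessThan_atLeast0 add.commute mult.commute)
  then show ?thesis by (simp add: sum.nat_group mult.commute)
qed

text \<open>For \<open>q \<le> b ^ K\<close> and \<open>k \<le> K\<close>: the ordered pairs from
  \<open>{p..<q}\<close>, diagonal included, that agree in the first \<open>k\<close> of their
  \<open>K\<close> base-\<open>b\<close> digits.\<close>

definition pairs_ge :: "nat \<Rightarrow> nat \<Rightarrow> nat \<Rightarrow> nat \<Rightarrow> nat \<Rightarrow> real" where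
  "pairs_ge b K p q k = (\<Sum>c<b ^ k. (cell_count p q (b ^ (K - k)) c)\<^sup>2)"

definition pairs_eq :: "nat \<Rightarrow> nat \<Rightarrow> nat \<Rightarrow> nat \<Rightarrow> nat \<Rightarrow> real" where
  "pairs_eq b K p q k = pairs_ge b K p q k - pairs_ge b K p q (Suc k)"

lemma card_same_fibre:
  assumes S: "finite S" and g: "\<And>c. c \<in> S \<Longrightarrow> g c < (n::nat)"
  shows "card {(c, d). c \<in> S \<and> d \<in> S \<and> g c = g d} = (\<Sum>i<n. (card {z \<in> S. g z = i})\<^sup>2)"
proof -
  let ?C = "\<lambda>i. {z \<in> S. g z = i}"
  have "{(c, d). c \<in> S \<and> d \<in> S \<and> g c = g d} = (\<Union>i<n. ?C i \<times> ?C i)"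
    using g by auto
  also have "card \<dots> = (\<Sum>i<n. card (?C i \<times> ?C i))"
    by (rule card_UN_disjoint) (use S in auto)
  finally show ?thesis by (simp add: card_cartesian_product power2_eq_square)
qed

lemma pairs_ge_card:
  assumes b: "b \<ge> 2" and k: "k \<le> K" and q: "q \<le> b ^ K"
  shows "pairs_ge b K p q k =
    real (card {(c, d). c \<in> {p..<q} \<and> d \<in> {p..<q} \<and> c div b ^ (K - k) = d div b ^ (K - k)})"
proof -
  define M where "M = b ^ (K - k)"
  have "b ^ k * M = b ^ K" unfolding M_def using k by (simp add: power_add[symmetric])
  then have "c div M < b ^ k" if "c \<in> {p..<q}" for c
    using that q by (intro less_mult_imp_div_less) simp
  then show ?thesis using card_same_fibre[of "{p..<q}" "\<lambda>c. c div M" "b ^ k"]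
    unfolding pairs_ge_def cell_count_def M_def[symmetric] by simp
qed

lemma pairs_ge_0:
  assumes "p \<le> q" "q \<le> b ^ K"
  shows "pairs_ge b K p q 0 = (real q - real p)\<^sup>2"
proof -
  have "{z \<in> {p..<q}. z div b ^ K = 0} = {p..<q}" using assms(2) by fastforce
  then have "cell_count p q (b ^ K) 0 = real q - real p"
    using assms(1) by (simp add: cell_count_def of_nat_diff)
  then show ?thesis by (simp add: pairs_ge_def)
qed

lemma pairs_ge_Suc:
  "pairs_ge b K p q (Suc k) =
     (\<Sum>c<b ^ k. \<Sum>i<b. (cell_count p q (b ^ (K - Suc k)) (b * c + i))\<^sup>2)"
  using sum_lessThan_mult[of "\<lambda>c. (cell_count p q (b ^ (K - Suc k)) c)\<^sup>2" b "b ^ k"]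
  by (simp add: pairs_ge_def)

lemma pow_diff_Suc: "k < K \<Longrightarrow> (b::nat) ^ (K - k) = b * b ^ (K - Suc k)"
  by (metis Suc_diff_Suc power_Suc)

text \<open>Exactly \<open>k\<close> common digits means the same cell at level \<open>k\<close>,
  but different ones among its \<open>b\<close> subcells.\<close>

lemma pairs_eq_cross_sum:
  assumes "b \<ge> 2" "k < K"
  shows "pairs_eq b K p q k =
    (\<Sum>c<b ^ k. cross_sum b (\<lambda>i. cell_count p q (b ^ (K - Suc k)) (b * c + i)))"
  unfolding pairs_eq_def pairs_ge_Suc unfolding pairs_ge_def cross_sum_def sum_subtractf
  using assms by (simp add: pow_diff_Suc cell_count_split)

lemma cross_sum_cell_ge:
  assumes "b \<ge> 2" "0 < M"
  shows "(real b - 1) * real M * (2 * cell_count p q (b * M) c - real (b * M)) \<le>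
    cross_sum b (\<lambda>i. cell_count p q M (b * c + i))"
  using cross_sum_ge[of b "\<lambda>i. cell_count p q M (b * c + i)" "real M"] assms
  by (simp add: cell_count_split cell_count_le)

lemma cross_sum_cell_nonneg: "0 \<le> cross_sum b (\<lambda>i. cell_count p q M (b * c + i))"
  by (intro cross_sum_nonneg cell_count_nonneg)

lemma pairs_eq_nonneg:
  assumes "b \<ge> 2" "k < K"
  shows "0 \<le> pairs_eq b K p q k"
  unfolding pairs_eq_cross_sum[OF assms] by (intro sum_nonneg cross_sum_cell_nonneg)

lemma pairs_eq_Suc_cells:
  assumes "b \<ge> 2" "Suc k < K"
  shows "pairs_eq b K p q (Suc k) =
    (\<Sum>c<b ^ k. \<Sum>i<b. cross_sum b (\<lambda>j. cell_count p q (b ^ (K - Suc (Suc k))) (b * (b * c + i) + j)))"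
  unfolding pairs_eq_cross_sum[OF assms]
  using sum_lessThan_mult[of "\<lambda>c. cross_sum b (\<lambda>j. cell_count p q (b ^ (K - Suc (Suc k))) (b * c + j))" b "b ^ k"]
  by simp

lemma unique_offset: "0 < b \<Longrightarrow> \<exists>i<b. \<forall>i'<b. i' \<noteq> i \<longrightarrow> b * c + i' \<noteq> (z::nat)"
  by (cases "\<exists>i<b. b * c + i = z") auto

text \<open>This is nonnegativity of the interval weight at \<open>Suc k\<close>. By
  \<open>sep\<close> no cell at level \<open>k\<close> contains both \<open>p\<close> and
  \<open>q - 1\<close>, so at most one of its subcells is cut and
  \<open>cross_sum_one_partial\<close> applies to each cell.\<close>

lemma pairs_eq_growth:
  assumes b: "b \<ge> 2" and k: "Suc k < K"
    and sep: "p div b ^ (K - k) \<noteq> (q - 1) div b ^ (K - k)"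
  shows "pairs_eq b K p q k \<le> real b * pairs_eq b K p q (Suc k)"
proof -
  have kK: "k < K" using k by simp
  define M where "M = b ^ (K - Suc (Suc k))"
  have M: "0 < M" using b by (simp add: M_def)
  have N: "b ^ (K - Suc k) = b * M" unfolding M_def using k by (rule pow_diff_Suc)
  have "cross_sum b (\<lambda>i. cell_count p q (b * M) (b * c + i)) \<le>
      real b * (\<Sum>i<b. cross_sum b (\<lambda>j. cell_count p q M (b * (b * c + i) + j)))" for c
  proof -
    have "\<not> ((\<exists>i<b. b * c + i = p div (b * M)) \<and> (\<exists>i<b. b * c + i = (q - 1) div (b * M)))"
    proof
      assume "(\<exists>i<b. b * c + i = p div (b * M)) \<and> (\<exists>i<b. b * c + i = (q - 1) div (b * M))"
      then obtain i i' where "i < b" "p div (b * M) = b * c + i"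
        "i' < b" "(q - 1) div (b * M) = b * c + i'" by metis
      then have "p div (b * (b * M)) = c" "(q - 1) div (b * (b * M)) = c"
        by (blast intro: div_cell_split)+
      then show False using sep by (simp add: pow_diff_Suc[OF kK] N)
    qed
    \<comment> \<open>\<open>z\<close> is the subcell index of the end point lying in cell
      \<open>c\<close>, or of either one if none does.\<close>
    then obtain z where z: "z \<in> {p div (b * M), (q - 1) div (b * M)}"
      "\<And>z'. z' \<in> {p div (b * M), (q - 1) div (b * M)} \<Longrightarrow> z' \<noteq> z \<Longrightarrow> \<forall>i<b. b * c + i \<noteq> z'"
      by auto
    obtain i0 where "i0 < b" "\<forall>i<b. i \<noteq> i0 \<longrightarrow> b * c + i \<noteq> z" using unique_offset[of b c z] b by auto
    then have i0: "i0 < b"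
      "\<And>i. i < b \<Longrightarrow> i \<noteq> i0 \<Longrightarrow> b * c + i \<noteq> p div (b * M) \<and> b * c + i \<noteq> (q - 1) div (b * M)"
      using z by (blast, metis insertI1 insertI2)
    show ?thesis
    proof (rule cross_sum_one_partial[OF b i0(1), of "real (b * M)" "real M"])
      show "cell_count p q (b * M) (b * c + i) = 0 \<or> cell_count p q (b * M) (b * c + i) = real (b * M)"
        if "i < b" "i \<noteq> i0" for i
        using i0(2)[OF that] M b by (intro cell_count_uncut) auto
      show "(real b - 1) * real M * (2 * cell_count p q (b * M) (b * c + i) - real (b * M)) \<le>
          cross_sum b (\<lambda>j. cell_count p q M (b * (b * c + i) + j))" for i
        by (rule cross_sum_cell_ge[OF b M])
      show "real (b * M) = real b * real M" by simp
    qed (use M b in \<open>auto intro!: cell_count_nonneg cell_count_le cross_sum_cell_nonneg simp del: of_nat_mult\<close>)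
  qed
  then have "(\<Sum>c<b ^ k. cross_sum b (\<lambda>i. cell_count p q (b * M) (b * c + i))) \<le>
      (\<Sum>c<b ^ k. real b * (\<Sum>i<b. cross_sum b (\<lambda>j. cell_count p q M (b * (b * c + i) + j))))"
    by (rule sum_mono)
  then show ?thesis
    unfolding pairs_eq_cross_sum[OF b kK] pairs_eq_Suc_cells[OF b k]
      N M_def[symmetric] by (simp only: sum_distrib_left[symmetric])
qed

text \<open>Here both end points may cut subcells of the same cell. With \<open>i = Suc k\<close>
  and the tail sum telescoped, this is the bound on a negative weight by the later weights.\<close>

lemma pairs_eq_le:
  assumes b: "b \<ge> 2" and k: "Suc k < K"
  shows "(real b - 1) * pairs_eq b K p q k \<le>
    (real b - 1) * pairs_ge b K p q (Suc k) + real b * (real b - 2) * pairs_eq b K p q (Suc k)"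
proof -
  have kK: "k < K" using k by simp
  define M where "M = b ^ (K - Suc (Suc k))"
  have M: "0 < M" using b by (simp add: M_def)
  have N: "b ^ (K - Suc k) = b * M" unfolding M_def using k by (rule pow_diff_Suc)
  have "(real b - 1) * cross_sum b (\<lambda>i. cell_count p q (b * M) (b * c + i)) \<le>
      (real b - 1) * (\<Sum>i<b. (cell_count p q (b * M) (b * c + i))\<^sup>2) +
      real b * (real b - 2) * (\<Sum>i<b. cross_sum b (\<lambda>j. cell_count p q M (b * (b * c + i) + j)))" for c
  proof -
    obtain i0 where ij1: "i0 < b" "\<forall>i<b. i \<noteq> i0 \<longrightarrow> b * c + i \<noteq> p div (b * M)"
      using unique_offset[of b c "p div (b * M)"] b by auto
    obtain j0 where ij2: "j0 < b" "\<forall>i<b. i \<noteq> j0 \<longrightarrow> b * c + i \<noteq> (q - 1) div (b * M)"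
      using unique_offset[of b c "(q - 1) div (b * M)"] b by auto
    have ij: "i0 < b" "\<And>i. i < b \<Longrightarrow> i \<noteq> i0 \<Longrightarrow> b * c + i \<noteq> p div (b * M)"
      "j0 < b" "\<And>i. i < b \<Longrightarrow> i \<noteq> j0 \<Longrightarrow> b * c + i \<noteq> (q - 1) div (b * M)"
      using ij1 ij2 by auto
    \<comment> \<open>If both ends single out the same subcell, any other one serves as the second:
      a subcell treated as partial may also be empty or full.\<close>
    obtain i1 where i1: "i1 < b" "i1 \<noteq> i0" "j0 \<in> {i0, i1}"
    proof (cases "j0 = i0")
      case True
      show ?thesis by (rule that[of "if i0 = 0 then 1 else 0"]) (use b True in auto)
    qed (use ij that in auto)
    show ?thesis
    proof (rule cross_sum_two_partial[OF ij(1) i1(1) i1(2)[symmetric], of "real (b * M)" "real M"])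
      show "cell_count p q (b * M) (b * c + i) = 0 \<or> cell_count p q (b * M) (b * c + i) = real (b * M)"
        if "i < b" "i \<noteq> i0" "i \<noteq> i1" for i
        using ij(2)[OF that(1,2)] ij(4)[of i] that i1 M b by (intro cell_count_uncut) auto
      show "(real b - 1) * real M * (2 * cell_count p q (b * M) (b * c + i) - real (b * M)) \<le>
          cross_sum b (\<lambda>j. cell_count p q M (b * (b * c + i) + j))" for i
        by (rule cross_sum_cell_ge[OF b M])
      show "real (b * M) = real b * real M" by simp
    qed (use M b in \<open>auto intro!: cell_count_nonneg cell_count_le cross_sum_cell_nonneg simp del: of_nat_mult\<close>)
  qed
  note cell = this
  have "(real b - 1) * pairs_eq b K p q k =
      (\<Sum>c<b ^ k. (real b - 1) * cross_sum b (\<lambda>i. cell_count p q (b * M) (b * c + i)))"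
    unfolding pairs_eq_cross_sum[OF b kK] N by (rule sum_distrib_left)
  also have "\<dots> \<le> (\<Sum>c<b ^ k. (real b - 1) * (\<Sum>i<b. (cell_count p q (b * M) (b * c + i))\<^sup>2) +
      real b * (real b - 2) * (\<Sum>i<b. cross_sum b (\<lambda>j. cell_count p q M (b * (b * c + i) + j))))"
    by (intro sum_mono cell)
  also have "\<dots> = (real b - 1) * (\<Sum>c<b ^ k. \<Sum>i<b. (cell_count p q (b * M) (b * c + i))\<^sup>2) +
      real b * (real b - 2) *
        (\<Sum>c<b ^ k. \<Sum>i<b. cross_sum b (\<lambda>j. cell_count p q M (b * (b * c + i) + j)))"
    unfolding sum.distrib by (intro arg_cong2[where f = "(+)"] sum_distrib_left[symmetric])
  finally show ?thesis
    unfolding pairs_eq_Suc_cells[OF b k] pairs_ge_Suc N M_def[symmetric] .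
qed

text \<open>Everything between two integers with the same first \<open>Suc k\<close> digits has
  these digits too, so levels \<open>k\<close> and \<open>Suc k\<close> both count all
  pairs.\<close>

lemma pairs_eq_0_if_same_cell:
  assumes b: "b \<ge> 2" and k: "k < K" and q: "p < q" "q \<le> b ^ K"
    and same: "p div b ^ (K - Suc k) = (q - 1) div b ^ (K - Suc k)"
  shows "pairs_eq b K p q k = 0"
proof -
  have eq: "pairs_ge b K p q l = (real (q - p))\<^sup>2" if "l \<le> Suc k" for l
  proof -
    have "b ^ (K - l) = b ^ (K - Suc k) * b ^ (Suc k - l)"
      unfolding power_add[symmetric] using that k by (intro arg_cong[where f = "\<lambda>n. b ^ n"]) simp
    then have s: "p div b ^ (K - l) = (q - 1) div b ^ (K - l)" by (simp only: div_mult2_eq same)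
    have h: "x div b ^ (K - l) = p div b ^ (K - l)" if "x \<in> {p..<q}" for x
    proof (rule antisym)
      have "x \<le> q - 1" using that by auto
      then show "x div b ^ (K - l) \<le> p div b ^ (K - l)" unfolding s by (rule div_le_mono)
      show "p div b ^ (K - l) \<le> x div b ^ (K - l)" using that by (intro div_le_mono) simp
    qed
    have *: "{(c, d). c \<in> {p..<q} \<and> d \<in> {p..<q} \<and> c div b ^ (K - l) = d div b ^ (K - l)} =
        {p..<q} \<times> {p..<q}" by (auto simp only: h)
    have "l \<le> K" using that k by simp
    from pairs_ge_card[OF b this q(2), of p] have "pairs_ge b K p q l = real (card ({p..<q} \<times> {p..<q}))"
      unfolding * .
    then show ?thesis by (simp add: card_cartesian_product power2_eq_square)
  qed
  show ?thesis by (simp add: pairs_eq_def eq)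
qed

text \<open>Cauchy-Schwarz over the \<open>b\<close> unit subcells of each cell. It makes the last
  interval weight nonnegative.\<close>

lemma pairs_ge_last:
  assumes b: "b \<ge> 2" and K: "1 \<le> K"
  shows "pairs_ge b K p q (K - 1) \<le> real b * pairs_ge b K p q K"
proof -
  obtain k where k: "K = Suc k" using K by (cases K) auto
  have "(cell_count p q (b * 1) c)\<^sup>2 \<le> real b * (\<Sum>i<b. (cell_count p q 1 (b * c + i))\<^sup>2)" for c
    using b
    using sum_squared_le_sum_of_squares[of "\<lambda>i. cell_count p q 1 (b * c + i)" "{..<b}"]
      cell_count_split[of b p q 1 c] by (simp add: mult.commute)
  then show ?thesis unfolding k pairs_ge_Suc sum_distrib_left
    by (simp add: pairs_ge_def sum_mono sum_distrib_left)
qed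

text \<open>The weights are chosen so that \<open>\<Sum>k\<le>l. b ^ k * interval_weight b K p q k\<close> is the probability that two
  scrambled points with exactly \<open>l\<close> common digits both have \<open>K\<close>-digit prefix in \<open>{p..<q}\<close>; the last
  weight, at \<open>k = K\<close>, makes the total equal to the squared length.\<close>

definition interval_weight :: "nat \<Rightarrow> nat \<Rightarrow> nat \<Rightarrow> nat \<Rightarrow> nat \<Rightarrow> real" where
  "interval_weight b K p q k =
     (if k = K then real b * pairs_ge b K p q K - pairs_ge b K p q (K - 1)
      else if k = 0 then real b * pairs_eq b K p q 0
      else real b * pairs_eq b K p q k - pairs_eq b K p q (k - 1)) / (real b ^ (2 * K) * (real b - 1))"

lemma sum_interval_weight_upto:
  assumes "b \<ge> 2" "l < K"
  shows "(\<Sum>k\<le>l. real b ^ k * interval_weight b K p q k) =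
    real b ^ Suc l * pairs_eq b K p q l / (real b ^ (2 * K) * (real b - 1))"
  using assms(2)
proof (induction l)
  case (Suc l)
  then show ?case by (simp add: interval_weight_def algebra_simps add_divide_distrib[symmetric])
qed (simp add: interval_weight_def)

text \<open>Telescoping downwards from the special weight at \<open>K\<close>, since
  \<open>pairs_eq\<close> at \<open>k\<close> is the drop of \<open>pairs_ge\<close> from
  \<open>k\<close> to \<open>Suc k\<close>.\<close>

lemma sum_interval_weight_from:
  assumes b: "b \<ge> 2" and x: "1 \<le> x" "x \<le> K"
  shows "(\<Sum>k\<in>{x..K}. interval_weight b K p q k) =
    (real b * pairs_ge b K p q x - pairs_ge b K p q (x - 1)) / (real b ^ (2 * K) * (real b - 1))"
  using x(2,1)
proof (induction x rule: inc_induct)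
  case (step x)
  then have "{x..K} = insert x {Suc x..K}" by auto
  then have "(\<Sum>k\<in>{x..K}. interval_weight b K p q k) =
      interval_weight b K p q x + (\<Sum>k\<in>{Suc x..K}. interval_weight b K p q k)" by simp
  also have "\<dots> = ((real b * pairs_eq b K p q x - pairs_eq b K p q (x - 1)) +
      (real b * pairs_ge b K p q (Suc x) - pairs_ge b K p q x)) / (real b ^ (2 * K) * (real b - 1))"
    using step by (simp add: interval_weight_def add_divide_distrib)
  also have "(real b * pairs_eq b K p q x - pairs_eq b K p q (x - 1)) +
      (real b * pairs_ge b K p q (Suc x) - pairs_ge b K p q x) =
      real b * pairs_ge b K p q x - pairs_ge b K p q (x - 1)"
    using step by (simp add: pairs_eq_def algebra_simps)
  finally show ?case .
qed (simp add: interval_weight_def)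

lemma sum_interval_weight:
  assumes b: "b \<ge> 2" and K: "1 \<le> K" and pq: "p \<le> q" "q \<le> b ^ K"
  shows "(\<Sum>k\<le>K. interval_weight b K p q k) = ((real q - real p) / real b ^ K)\<^sup>2"
proof -
  have "{..K} = insert 0 {1..K}" by auto
  then have "(\<Sum>k\<le>K. interval_weight b K p q k) =
      interval_weight b K p q 0 + (\<Sum>k\<in>{1..K}. interval_weight b K p q k)" by simp
  also have "\<dots> = (real b * pairs_eq b K p q 0 + (real b * pairs_ge b K p q 1 - pairs_ge b K p q 0)) /
      (real b ^ (2 * K) * (real b - 1))"
    using sum_interval_weight_from[OF b, of 1 K p q] K by (simp add: interval_weight_def add_divide_distrib)
  also have "\<dots> = (real b - 1) * pairs_ge b K p q 0 / (real b ^ (2 * K) * (real b - 1))"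
    by (simp add: pairs_eq_def algebra_simps)
  also have "\<dots> = pairs_ge b K p q 0 / real b ^ (2 * K)" using b by simp
  finally show ?thesis by (simp add: pairs_ge_0[OF pq] power_divide power_mult[symmetric] mult.commute)
qed

lemma admissible_interval_weight:
  assumes b: "b \<ge> 2" and K: "1 \<le> K" and pq: "p < q" "q \<le> b ^ K"
  shows "admissible_weights b K (interval_weight b K p q)"
proof -
  let ?D = "real b ^ (2 * K) * (real b - 1)"
  have D: "?D > 0" using b by simp
  let ?same = "\<lambda>k. p div b ^ (K - k) = (q - 1) div b ^ (K - k)"
  have same_mono: "?same l" if "?same k" "l \<le> k" "k \<le> K" for k l
  proof -
    have "b ^ (K - l) = b ^ (K - k) * b ^ (k - l)" using that by (simp add: power_add[symmetric])
    then show ?thesis using that(1) by (simp add: div_mult2_eq)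
  qed
  have last: "0 \<le> interval_weight b K p q K"
    using pairs_ge_last[OF b K] D by (simp add: interval_weight_def)
  have zero: "pairs_eq b K p q k = 0" if "?same (Suc k)" "k < K" for k
    using pairs_eq_0_if_same_cell[OF b that(2) pq that(1)] .
  show ?thesis
  proof (cases "\<forall>k\<le>K. ?same k")
    case True
    \<comment> \<open>Here \<open>q = p + 1\<close>. No weight is negative, so the exceptional index
      may be chosen freely; 1 is taken.\<close>
    have "0 \<le> interval_weight b K p q k" if "k \<le> K" for k
      using that last zero[of k] zero[of "k - 1"] True by (cases "k = K") (auto simp: interval_weight_def)
    moreover from this have "- interval_weight b K p q 1 * (real b - 1) \<le> 0"
      using K b by (simp add: mult_le_0_iff)
    moreover from calculation have "0 \<le> (\<Sum>k\<in>{1<..K}. interval_weight b K p q k)"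
      by (intro sum_nonneg) simp
    ultimately show ?thesis unfolding admissible_weights_def using K
      by (intro exI[of _ 1] conjI) (auto intro: order_trans)
  next
    case False
    define i where "i = (LEAST k. k \<le> K \<and> \<not> ?same k)"
    have i: "i \<le> K" "\<not> ?same i"
      using LeastI_ex[of "\<lambda>k. k \<le> K \<and> \<not> ?same k"] False by (auto simp: i_def)
    have below: "?same k" if "k < i" for k
      using not_less_Least[of k "\<lambda>k. k \<le> K \<and> \<not> ?same k"] that i(1) by (auto simp: i_def)
    have "?same 0" using pq by simp
    then have i1: "1 \<le> i" using i by (cases i) auto
    have nn: "0 \<le> interval_weight b K p q k" if k: "k \<le> K" "k \<noteq> i" for k
    proof -
      consider "k = K" | "k < i" | "i < k" "k < K" using k by linarith
      then show ?thesis
      proof cases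
        case 2
        then have "k = 0 \<or> pairs_eq b K p q (k - 1) = 0"
          using zero[of "k - 1"] below[of k] i by (cases k) auto
        then show ?thesis using pairs_eq_nonneg[OF b, of k K p q] 2 i D
          by (auto simp: interval_weight_def)
      next
        case 3
        have "\<not> ?same (k - 1)"
        proof
          assume "?same (k - 1)"
          then have "?same i" by (rule same_mono) (use 3 in auto)
          then show False using i by simp
        qed
        then have "pairs_eq b K p q (k - 1) \<le> real b * pairs_eq b K p q (Suc (k - 1))"
          by (intro pairs_eq_growth[OF b]) (use 3 in auto)
        then show ?thesis using 3 D by (auto simp: interval_weight_def)
      qed (use last in simp)
    qed
    have cond1: "- interval_weight b K p q i * (real b - 1) \<le> (\<Sum>k\<in>{i<..K}. interval_weight b K p q k)"
    proof (cases "i = K")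
      case True
      then show ?thesis using last b by (simp add: mult_le_0_iff)
    next
      case False
      then have iK: "i < K" using i by simp
      obtain k where k: "i = Suc k" using i1 by (cases i) auto
      have "{i<..K} = {Suc i..K}" by auto
      then have "(\<Sum>k\<in>{i<..K}. interval_weight b K p q k) =
          (real b * pairs_ge b K p q (Suc i) - pairs_ge b K p q i) / ?D"
        using sum_interval_weight_from[OF b, of "Suc i" K p q] iK by simp
      moreover have "- interval_weight b K p q i * (real b - 1) =
          (- (real b * pairs_eq b K p q i - pairs_eq b K p q k) * (real b - 1)) / ?D"
        using iK k unfolding interval_weight_def by (simp only: minus_divide_left times_divide_eq_left) simp
      moreover have "- (real b * pairs_eq b K p q i - pairs_eq b K p q k) * (real b - 1) \<le>
          real b * pairs_ge b K p q (Suc i) - pairs_ge b K p q i"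
        using pairs_eq_le[OF b, of k K p q] iK k
        by (simp add: pairs_eq_def algebra_simps)
      ultimately show ?thesis using D by (simp only: divide_right_mono less_imp_le)
    qed
    have cond2: "0 \<le> interval_weight b K p q (i - 1) + real b * interval_weight b K p q i"
    proof (cases "i = K")
      case True
      then show ?thesis using last nn[of "i - 1"] i1 by simp
    next
      case False
      then have iK: "i < K" using i by simp
      \<comment> \<open>With no pairs separating before level \<open>i - 1\<close>, the weight at
        \<open>i - 1\<close> is \<open>b * pairs_eq b K p q (i - 1)\<close> up to the denominator.
        It cancels the negative part of \<open>b\<close> times the weight at
        \<open>i\<close>.\<close>
      have z: "i - 1 = 0 \<or> pairs_eq b K p q (i - 1 - 1) = 0"
      proof (cases "i - 1")
        case (Suc k)
        then show ?thesis using zero[of k] below[of "Suc k"] iK by simp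
      qed simp
      have "interval_weight b K p q (i - 1) + real b * interval_weight b K p q i =
          real b * real b * pairs_eq b K p q i / ?D"
        using z iK i1 by (auto simp: interval_weight_def add_divide_distrib[symmetric] algebra_simps)
      then show ?thesis using pairs_eq_nonneg[OF b iK] D by simp
    qed
    show ?thesis unfolding admissible_weights_def
      by (rule exI[of _ i]) (intro conjI allI impI i1 i(1) cond1 cond2 nn)
  qed
qed

subsection \<open>Pairs of net points\<close>

definition cell_index :: "nat \<Rightarrow> nat \<Rightarrow> real \<Rightarrow> nat" where
  "cell_index b k x = nat \<lfloor>real b ^ k * x\<rfloor>"

lemma cell_index_0: "0 \<le> x \<Longrightarrow> x < 1 \<Longrightarrow> cell_index b 0 x = 0"
  by (simp add: cell_index_def floor_eq_iff)

lemma cell_index_eq_iff: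
  assumes "b \<ge> 2" "0 \<le> x"
  shows "cell_index b k x = c \<longleftrightarrow> real c / real b ^ k \<le> x \<and> x < (real c + 1) / real b ^ k"
proof -
  have "cell_index b k x = c \<longleftrightarrow> \<lfloor>real b ^ k * x\<rfloor> = int c"
    using assms by (simp add: cell_index_def nat_eq_iff)
  also have "\<dots> \<longleftrightarrow> real c \<le> real b ^ k * x \<and> real b ^ k * x < real c + 1"
    by (simp add: floor_eq_iff)
  finally show ?thesis using assms by (simp add: pos_divide_le_eq pos_less_divide_eq mult.commute)
qed

lemma cell_index_less:
  assumes "b \<ge> 2" "0 \<le> x" "x < 1"
  shows "cell_index b k x < b ^ k"
proof -
  have "real b ^ k * x < real b ^ k" using assms by simp
  then have "\<lfloor>real b ^ k * x\<rfloor> < int b ^ k" by (simp add: floor_less_iff)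
  then show ?thesis using assms by (simp add: cell_index_def nat_less_iff)
qed

lemma digit_less: "b \<ge> 2 \<Longrightarrow> digit b x i < b"
  by (simp add: digit_def nat_less_iff)

lemma cell_index_Suc:
  assumes "b \<ge> 2" "0 \<le> x"
  shows "cell_index b (Suc k) x = b * cell_index b k x + digit b x (Suc k)"
proof -
  let ?y = "real b ^ Suc k * x"
  have "real b ^ k * x = ?y / real_of_int (int b)" using assms by simp
  then have "\<lfloor>real b ^ k * x\<rfloor> = \<lfloor>?y\<rfloor> div int b"
    using floor_divide_real_eq_div[of "int b" ?y] by simp
  then have "\<lfloor>?y\<rfloor> = int b * \<lfloor>real b ^ k * x\<rfloor> + \<lfloor>?y\<rfloor> mod int b" by simp
  moreover have "0 \<le> \<lfloor>real b ^ k * x\<rfloor>" "0 \<le> \<lfloor>?y\<rfloor> mod int b" "0 \<le> \<lfloor>?y\<rfloor>"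
    using assms by auto
  ultimately have "int (cell_index b (Suc k) x) = int (b * cell_index b k x + digit b x (Suc k))"
    by (simp add: cell_index_def digit_def)
  then show ?thesis by (simp only: of_nat_eq_iff)
qed

lemma cell_index_Suc_eq_iff:
  assumes "b \<ge> 2" "0 \<le> x" "0 \<le> y"
  shows "cell_index b (Suc k) x = cell_index b (Suc k) y \<longleftrightarrow>
    cell_index b k x = cell_index b k y \<and> digit b x (Suc k) = digit b y (Suc k)"
proof -
  have "b * a + d = b * a' + d' \<longleftrightarrow> a = a' \<and> d = d'" if "d < b" "d' < b" for a a' d d'
  proof
    assume e: "b * a + d = b * a' + d'"
    have "(b * a + d) div b = a" "(b * a' + d') div b = a'" using that by simp_all
    then show "a = a' \<and> d = d'" using e by simp
  qed simp
  then show ?thesis using assms by (simp add: cell_index_Suc digit_less)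
qed

lemma cell_index_mono_eq:
  assumes "b \<ge> 2" "0 \<le> x" "0 \<le> y" and "k \<le> l" "cell_index b l x = cell_index b l y"
  shows "cell_index b k x = cell_index b k y"
  using assms(4,5) by (induction rule: inc_induct) (use assms cell_index_Suc_eq_iff in auto)

lemma digit_words_eq_iff:
  assumes "b \<ge> 2" "0 \<le> x" "x < 1" "0 \<le> y" "y < 1"
  shows "map (digit b x) [1..<Suc i] = map (digit b y) [1..<Suc i] \<longleftrightarrow> cell_index b i x = cell_index b i y"
proof (induction i)
  case (Suc i)
  then show ?case using assms by (simp add: cell_index_Suc_eq_iff)
qed (use assms in \<open>simp add: cell_index_0\<close>)

text \<open>Coarsens a level vector to total \<open>m\<close>, the finest total for which the net
  property gives a count.\<close>

lemma exists_le_with_sum: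
  fixes k :: "'s::finite \<Rightarrow> nat"
  assumes "m \<le> (\<Sum>j\<in>UNIV. k j)"
  shows "\<exists>k'. (\<forall>j. k' j \<le> k j) \<and> (\<Sum>j\<in>UNIV. k' j) = m"
  using assms
proof (induction "(\<Sum>j\<in>UNIV. k j) - m" arbitrary: k)
  case 0
  then show ?case by (intro exI[of _ k]) auto
next
  case (Suc d)
  then have "(\<Sum>j\<in>UNIV. k j) \<noteq> 0" by linarith
  then obtain i where i: "k i \<noteq> 0" by (meson sum.neutral)
  let ?k = "k(i := k i - 1)"
  have "(\<Sum>j\<in>UNIV. k j) = k i + (\<Sum>j\<in>UNIV - {i}. k j)" by (simp add: sum.remove)
  moreover have "(\<Sum>j\<in>UNIV. ?k j) = (k i - 1) + (\<Sum>j\<in>UNIV - {i}. k j)"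
    by (subst sum.remove[of _ i]) (auto intro!: sum.cong)
  ultimately have s: "(\<Sum>j\<in>UNIV. k j) = Suc (\<Sum>j\<in>UNIV. ?k j)" using i by simp
  have "d = (\<Sum>j\<in>UNIV. ?k j) - m" "m \<le> (\<Sum>j\<in>UNIV. ?k j)" using Suc.hyps(2) s by linarith+
  from Suc.hyps(1)[OF this] obtain k' where k': "\<forall>j. k' j \<le> ?k j" "(\<Sum>j\<in>UNIV. k' j) = m" by blast
  have "k' j \<le> k j" for j using k'(1)[rule_format, of j] by (cases "j = i") auto
  then show ?case using k'(2) by blast
qed

definition same_cell :: "nat \<Rightarrow> ('s \<Rightarrow> nat) \<Rightarrow> real ^ 's \<Rightarrow> real ^ 's \<Rightarrow> bool" where
  "same_cell b k u v \<longleftrightarrow> (\<forall>j. cell_index b (k j) (u $ j) = cell_index b (k j) (v $ j))"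

lemma zero_net_coord:
  assumes "zero_net b m P" "u \<in> P"
  shows "0 \<le> u $ j" "u $ j < 1"
  using assms by (auto simp: zero_net_def half_open_box_def)

lemma card_same_cell:
  fixes P :: "(real ^ 's::finite) set"
  assumes b: "b \<ge> 2" and P: "zero_net b m P" and u: "u \<in> P" and k: "(\<Sum>j\<in>UNIV. k j) \<le> m"
  shows "card {v \<in> P. same_cell b k u v} = b ^ (m - (\<Sum>j\<in>UNIV. k j))"
proof -
  define c where "c = (\<lambda>j. cell_index b (k j) (u $ j))"
  have "{v \<in> P. same_cell b k u v} = P \<inter> elementary_interval b k c"
  proof -
    have "same_cell b k u v \<longleftrightarrow> v \<in> elementary_interval b k c" if "v \<in> P" for v
      using cell_index_eq_iff[OF b zero_net_coord(1)[OF P that]]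
      unfolding same_cell_def elementary_interval_def half_open_box_def c_def mem_Collect_eq
        vec_lambda_beta by (metis (no_types, lifting))
    then show ?thesis by auto
  qed
  moreover have "\<forall>j. c j < b ^ k j"
    unfolding c_def using cell_index_less[OF b] zero_net_coord[OF P u] by auto
  ultimately show ?thesis using P k by (simp add: zero_net_def)
qed

text \<open>If the total exceeds \<open>m\<close>, a coarser cell of total exactly \<open>m\<close>
  already holds a single net point, so there are no pairs; the truncated exponent gives
  \<open>b ^ 0 - 1 = 0\<close> as well.\<close>

lemma card_pairs_same_cell:
  fixes P :: "(real ^ 's::finite) set"
  assumes b: "b \<ge> 2" and P: "zero_net b m P"
  shows "card {(u, v). u \<in> P \<and> v \<in> P \<and> u \<noteq> v \<and> same_cell b k u v} =
    b ^ m * (b ^ (m - (\<Sum>j\<in>UNIV. k j)) - 1)"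
proof (cases "(\<Sum>j\<in>UNIV. k j) \<le> m")
  case True
  have fin: "finite P" "card P = b ^ m" using P by (auto simp: zero_net_def)
  have "{(u, v). u \<in> P \<and> v \<in> P \<and> u \<noteq> v \<and> same_cell b k u v} =
      (SIGMA u:P. {v \<in> P. same_cell b k u v} - {u})" by auto
  also have "card \<dots> = (\<Sum>u\<in>P. card ({v \<in> P. same_cell b k u v} - {u}))"
    using fin by (intro card_SigmaI) auto
  also have "\<dots> = (\<Sum>u\<in>P. b ^ (m - (\<Sum>j\<in>UNIV. k j)) - 1)"
  proof (rule sum.cong)
    fix u assume u: "u \<in> P"
    have "u \<in> {v \<in> P. same_cell b k u v}" using u by (simp add: same_cell_def)
    then show "card ({v \<in> P. same_cell b k u v} - {u}) = b ^ (m - (\<Sum>j\<in>UNIV. k j)) - 1"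
      using card_same_cell[OF b P u True] fin by simp
  qed simp
  finally show ?thesis using fin by simp
next
  case False
  then obtain k' where k': "\<forall>j. k' j \<le> k j" "(\<Sum>j\<in>UNIV. k' j) = m"
    using exists_le_with_sum[of m k] by auto
  have "u = v" if uv: "u \<in> P" "v \<in> P" "same_cell b k u v" for u v
  proof -
    have "same_cell b k' u v"
      using uv k'(1) cell_index_mono_eq[OF b] zero_net_coord(1)[OF P] unfolding same_cell_def by blast
    then have mem: "u \<in> {v \<in> P. same_cell b k' u v}" "v \<in> {v \<in> P. same_cell b k' u v}"
      using uv by (auto simp: same_cell_def)
    have "card {v \<in> P. same_cell b k' u v} = 1"
      using card_same_cell[OF b P uv(1), of k'] k'(2) by simp
    then obtain w where "{v \<in> P. same_cell b k' u v} = {w}" by (rule card_1_singletonE)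
    then show ?thesis using mem by (metis singletonD)
  qed
  then have "{(u, v). u \<in> P \<and> v \<in> P \<and> u \<noteq> v \<and> same_cell b k u v} = {}" by auto
  then show ?thesis using False by (simp only: card.empty) simp
qed

text \<open>Meaningful only for points that separate at some level; otherwise \<open>LEAST\<close>
  ranges over an empty set.\<close>

definition common_digits :: "nat \<Rightarrow> real \<Rightarrow> real \<Rightarrow> nat" where
  "common_digits b x y = (LEAST k. cell_index b (Suc k) x \<noteq> cell_index b (Suc k) y)"

lemma common_digits:
  assumes b: "b \<ge> 2" and x: "0 \<le> x" "x < 1" and y: "0 \<le> y" "y < 1"
    and d: "cell_index b m x \<noteq> cell_index b m y"
  shows "common_digits b x y < m"
    and "cell_index b k x = cell_index b k y \<longleftrightarrow> k \<le> common_digits b x y"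
proof -
  let ?Q = "\<lambda>k. cell_index b (Suc k) x \<noteq> cell_index b (Suc k) y"
  obtain m' where m': "m = Suc m'" using d x y by (cases m) (auto simp: cell_index_0)
  have "?Q m'" using d m' by simp
  then have Q: "?Q (common_digits b x y)" and le: "common_digits b x y \<le> m'"
    unfolding common_digits_def by (rule LeastI, rule Least_le)
  show "common_digits b x y < m" using le m' by simp
  show "cell_index b k x = cell_index b k y \<longleftrightarrow> k \<le> common_digits b x y"
  proof
    assume e: "cell_index b k x = cell_index b k y"
    show "k \<le> common_digits b x y"
    proof (rule ccontr)
      assume "\<not> ?thesis"
      then have "Suc (common_digits b x y) \<le> k" by simp
      from cell_index_mono_eq[OF b x(1) y(1) this e] Q show False by simp
    qed
  next
    assume k: "k \<le> common_digits b x y"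
    show "cell_index b k x = cell_index b k y"
    proof (cases k)
      case (Suc k')
      then have "k' < common_digits b x y" using k by simp
      from not_less_Least[OF this[unfolded common_digits_def]] show ?thesis using Suc by simp
    qed (use x y in \<open>simp add: cell_index_0\<close>)
  qed
qed

text \<open>Spending all \<open>m\<close> levels on coordinate \<open>j\<close> yields slabs with
  one net point each. So distinct net points share fewer than \<open>m\<close> digits in every
  coordinate.\<close>

lemma zero_net_separated:
  fixes P :: "(real ^ 's::finite) set"
  assumes b: "b \<ge> 2" and P: "zero_net b m P" and uv: "u \<in> P" "v \<in> P" "u \<noteq> v"
  shows "cell_index b m (u $ j) \<noteq> cell_index b m (v $ j)"
proof
  assume e: "cell_index b m (u $ j) = cell_index b m (v $ j)"
  define k where "k = (\<lambda>i. if i = j then m else 0)"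
  have "same_cell b k u v"
    using e zero_net_coord[OF P uv(1)] zero_net_coord[OF P uv(2)]
    by (simp add: same_cell_def k_def cell_index_0)
  moreover have "(\<Sum>i\<in>UNIV. k i) = m" by (simp add: k_def)
  then have "card {(u, v). u \<in> P \<and> v \<in> P \<and> u \<noteq> v \<and> same_cell b k u v} = 0"
    using card_pairs_same_cell[OF b P, of k] by simp
  moreover have "finite {(u, v). u \<in> P \<and> v \<in> P \<and> u \<noteq> v \<and> same_cell b k u v}"
    by (rule finite_subset[of _ "P \<times> P"]) (use P in \<open>auto simp: zero_net_def\<close>)
  ultimately show False using uv by auto
qed

text \<open>Pad the inner sums with zeros up to \<open>K\<close>, expand the product over level
  vectors \<open>k\<close>, and exchange with the sum over pairs. That each \<open>k j\<close> is at
  most the number of common digits in coordinate \<open>j\<close> is exactly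
  \<open>same_cell b k u v\<close>.\<close>

lemma net_pair_sum_le:
  fixes P :: "(real ^ 's::finite) set" and c :: "'s \<Rightarrow> nat \<Rightarrow> real"
  assumes b: "b \<ge> 2" "CARD('s) \<le> b" and P: "zero_net b m P" and K: "m \<le> K"
    and c: "\<And>j. admissible_weights b K (c j)"
  shows "(\<Sum>(u, v)\<in>{(u, v). u \<in> P \<and> v \<in> P \<and> u \<noteq> v}.
            \<Prod>j\<in>UNIV. \<Sum>k\<le>common_digits b (u $ j) (v $ j). real b ^ k * c j k)
         \<le> real b ^ m * (real b ^ m - 1) * (\<Prod>j\<in>UNIV. \<Sum>k\<le>K. c j k)"
proof -
  let ?D = "{(u, v). u \<in> P \<and> v \<in> P \<and> u \<noteq> v}"
  let ?F = "PiE UNIV (\<lambda>_. {..K}) :: ('s \<Rightarrow> nat) set"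
  let ?p = "\<lambda>k. \<Prod>j\<in>UNIV. c j (k j)"
  let ?s = "\<lambda>k. \<Sum>j\<in>UNIV. k j :: nat"
  have finD: "finite ?D"
    by (rule finite_subset[of _ "P \<times> P"]) (use P in \<open>auto simp: zero_net_def\<close>)
  have "(\<Prod>j\<in>UNIV. \<Sum>k\<le>common_digits b (u $ j) (v $ j). real b ^ k * c j k) =
      (\<Sum>k\<in>?F. if same_cell b k u v then real b ^ ?s k * ?p k else 0)"
    if uv: "u \<in> P" "v \<in> P" "u \<noteq> v" for u v
  proof -
    have cd: "common_digits b (u $ j) (v $ j) < m"
      "cell_index b k (u $ j) = cell_index b k (v $ j) \<longleftrightarrow> k \<le> common_digits b (u $ j) (v $ j)" for j k
      using common_digits[OF b(1) zero_net_coord[OF P uv(1)] zero_net_coord[OF P uv(2)]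
          zero_net_separated[OF b(1) P uv]] by auto
    have "(\<Prod>j\<in>UNIV. \<Sum>k\<le>common_digits b (u $ j) (v $ j). real b ^ k * c j k) =
        (\<Prod>j\<in>UNIV. \<Sum>k\<in>{..K}. if k \<le> common_digits b (u $ j) (v $ j) then real b ^ k * c j k else 0)"
    proof (rule prod.cong)
      fix j :: 's
      have "{k. k \<le> K \<and> k \<le> common_digits b (u $ j) (v $ j)} = {..common_digits b (u $ j) (v $ j)}"
        using cd(1)[of j] K by auto
      then show "(\<Sum>k\<le>common_digits b (u $ j) (v $ j). real b ^ k * c j k) =
        (\<Sum>k\<in>{..K}. if k \<le> common_digits b (u $ j) (v $ j) then real b ^ k * c j k else 0)"
        by (simp add: sum.inter_filter[symmetric])
    qed simp
    also have "\<dots> = (\<Sum>k\<in>?F. \<Prod>j\<in>UNIV.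
        if k j \<le> common_digits b (u $ j) (v $ j) then real b ^ k j * c j (k j) else 0)"
      by (rule prod_sum_PiE) simp_all
    also have "\<dots> = (\<Sum>k\<in>?F. if same_cell b k u v then real b ^ ?s k * ?p k else 0)"
    proof (rule sum.cong)
      fix k :: "'s \<Rightarrow> nat"
      show "(\<Prod>j\<in>UNIV. if k j \<le> common_digits b (u $ j) (v $ j) then real b ^ k j * c j (k j) else 0) =
          (if same_cell b k u v then real b ^ ?s k * ?p k else 0)"
      proof (cases "same_cell b k u v")
        case True
        then show ?thesis by (simp add: same_cell_def cd(2) prod.distrib power_sum)
      next
        case False
        then obtain j where "\<not> k j \<le> common_digits b (u $ j) (v $ j)" by (auto simp: same_cell_def cd(2))
        then show ?thesis using False by (auto intro!: prod_zero)
      qed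
    qed simp
    finally show ?thesis .
  qed
  then have "(\<Sum>(u, v)\<in>?D. \<Prod>j\<in>UNIV. \<Sum>k\<le>common_digits b (u $ j) (v $ j). real b ^ k * c j k) =
      (\<Sum>(u, v)\<in>?D. \<Sum>k\<in>?F. if same_cell b k u v then real b ^ ?s k * ?p k else 0)"
    by (intro sum.cong) auto
  also have "\<dots> = (\<Sum>k\<in>?F. \<Sum>(u, v)\<in>?D. if same_cell b k u v then real b ^ ?s k * ?p k else 0)"
    unfolding case_prod_unfold by (rule sum.swap)
  also have "\<dots> = (\<Sum>k\<in>?F. real b ^ m * (?p k * (real b ^ ?s k * (real b ^ (m - ?s k) - 1))))"
  proof (rule sum.cong)
    fix k :: "'s \<Rightarrow> nat"
    have "(\<Sum>(u, v)\<in>?D. if same_cell b k u v then real b ^ ?s k * ?p k else 0) =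
        (\<Sum>z\<in>{z \<in> ?D. same_cell b k (fst z) (snd z)}. real b ^ ?s k * ?p k)"
      unfolding case_prod_unfold by (rule sum.inter_filter[symmetric]) (use finD in \<open>simp add: case_prod_unfold\<close>)
    also have "{z \<in> ?D. same_cell b k (fst z) (snd z)} =
        {(u, v). u \<in> P \<and> v \<in> P \<and> u \<noteq> v \<and> same_cell b k u v}" by auto
    also have "(\<Sum>z\<in>\<dots>. real b ^ ?s k * ?p k) = real (b ^ m * (b ^ (m - ?s k) - 1)) * (real b ^ ?s k * ?p k)"
      using card_pairs_same_cell[OF b(1) P, of k] by simp
    also have "real (b ^ m * (b ^ (m - ?s k) - 1)) = real b ^ m * (real b ^ (m - ?s k) - 1)"
      using b(1) by (simp add: of_nat_diff)
    finally show "(\<Sum>(u, v)\<in>?D. if same_cell b k u v then real b ^ ?s k * ?p k else 0) =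
        real b ^ m * (?p k * (real b ^ ?s k * (real b ^ (m - ?s k) - 1)))" by (simp add: mult_ac)
  qed simp
  also have "\<dots> = real b ^ m * (\<Sum>k\<in>?F. ?p k * (real b ^ ?s k * (real b ^ (m - ?s k) - 1)))"
    by (rule sum_distrib_left[symmetric])
  also have "\<dots> \<le> real b ^ m * ((real b ^ m - 1) * (\<Prod>j\<in>UNIV. \<Sum>k\<le>K. c j k))"
    by (intro mult_left_mono net_weighted_sum_le b c) simp
  finally show ?thesis by (simp add: mult.assoc)
qed

subsection \<open>Joint law of scrambled digits\<close>

text \<open>Composing with the transposition of \<open>c\<close> and \<open>x\<close> turns
  \<open>p x = c\<close> into a fixed point \<open>x\<close>, leaving a permutation of
  \<open>S - {x}\<close>. The map is its own inverse.\<close>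

lemma card_permutes_fix1:
  assumes S: "finite S" and x: "x \<in> S" "c \<in> S"
  shows "card {p. p permutes S \<and> p x = c} = fact (card S - 1)"
proof -
  have "bij_betw (\<lambda>p. Transposition.transpose c x \<circ> p) {p. p permutes S \<and> p x = c} {p. p permutes (S - {x})}"
  proof (rule bij_betwI[where g = "\<lambda>p. Transposition.transpose c x \<circ> p"])
    show "(\<lambda>p. Transposition.transpose c x \<circ> p) \<in> {p. p permutes S \<and> p x = c} \<rightarrow> {p. p permutes (S - {x})}"
    proof
      fix p assume "p \<in> {p. p permutes S \<and> p x = c}"
      then have p: "p permutes S" "p x = c" by auto
      have "Transposition.transpose c x \<circ> p permutes S"
        using p(1) x by (intro permutes_compose permutes_swap_id)
      then have "Transposition.transpose c x \<circ> p permutes (S - {x})"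
        by (rule permutes_superset) (use p in auto)
      then show "Transposition.transpose c x \<circ> p \<in> {p. p permutes (S - {x})}" by simp
    qed
    show "(\<lambda>p. Transposition.transpose c x \<circ> p) \<in> {p. p permutes (S - {x})} \<rightarrow> {p. p permutes S \<and> p x = c}"
    proof
      fix p assume "p \<in> {p. p permutes (S - {x})}"
      then have p: "p permutes (S - {x})" by simp
      then have "p permutes S" by (rule permutes_subset) auto
      then have "Transposition.transpose c x \<circ> p permutes S"
        using x by (intro permutes_compose permutes_swap_id)
      moreover have "p x = x" using p by (rule permutes_not_in) simp
      ultimately show "Transposition.transpose c x \<circ> p \<in> {p. p permutes S \<and> p x = c}" by simp
    qed
  qed (simp_all add: fun_eq_iff)
  then have "card {p. p permutes S \<and> p x = c} = card {p. p permutes (S - {x})}"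
    by (rule bij_betw_same_card)
  also have "\<dots> = fact (card S - 1)"
    by (rule card_permutations) (use S x in auto)
  finally show ?thesis .
qed

lemma card_permutes_fix2:
  assumes S: "finite S" and x: "x \<in> S" "y \<in> S" "x \<noteq> y" and c: "c \<in> S" "d \<in> S" "c \<noteq> d"
  shows "card {p. p permutes S \<and> p x = c \<and> p y = d} = fact (card S - 2)"
proof -
  let ?t = "Transposition.transpose c x"
  \<comment> \<open>The value \<open>d\<close> may be \<open>x\<close> itself; then the
    transposition moves it to \<open>c\<close>.\<close>
  have td: "?t d \<in> S - {x}" using x c by (auto simp: Transposition.transpose_def)
  have "bij_betw (\<lambda>p. ?t \<circ> p) {p. p permutes S \<and> p x = c \<and> p y = d}
      {p. p permutes (S - {x}) \<and> p y = ?t d}"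
  proof (rule bij_betwI[where g = "\<lambda>p. ?t \<circ> p"])
    show "(\<lambda>p. ?t \<circ> p) \<in> {p. p permutes S \<and> p x = c \<and> p y = d} \<rightarrow> {p. p permutes (S - {x}) \<and> p y = ?t d}"
    proof
      fix p assume "p \<in> {p. p permutes S \<and> p x = c \<and> p y = d}"
      then have p: "p permutes S" "p x = c" "p y = d" by auto
      have "?t \<circ> p permutes S"
        using p(1) x c by (intro permutes_compose permutes_swap_id)
      then have "?t \<circ> p permutes (S - {x})"
        by (rule permutes_superset) (use p in auto)
      then show "?t \<circ> p \<in> {p. p permutes (S - {x}) \<and> p y = ?t d}" using p by simp
    qed
    show "(\<lambda>p. ?t \<circ> p) \<in> {p. p permutes (S - {x}) \<and> p y = ?t d} \<rightarrow> {p. p permutes S \<and> p x = c \<and> p y = d}"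
    proof
      fix p assume "p \<in> {p. p permutes (S - {x}) \<and> p y = ?t d}"
      then have p: "p permutes (S - {x})" "p y = ?t d" by simp_all
      from p(1) have "p permutes S" by (rule permutes_subset) auto
      then have "?t \<circ> p permutes S"
        using x c by (intro permutes_compose permutes_swap_id)
      moreover have "p x = x" using p(1) by (rule permutes_not_in) simp
      ultimately show "?t \<circ> p \<in> {p. p permutes S \<and> p x = c \<and> p y = d}" using p(2) by simp
    qed
  qed (simp_all add: fun_eq_iff)
  then have "card {p. p permutes S \<and> p x = c \<and> p y = d} = card {p. p permutes (S - {x}) \<and> p y = ?t d}"
    by (rule bij_betw_same_card)
  also have "\<dots> = fact (card (S - {x}) - 1)"
    by (rule card_permutes_fix1) (use S x td in auto)
  finally show ?thesis using S x by (simp add: numeral_2_eq_2)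
qed

section \<open>Leading digits encoded as integers\<close>

definition digit_word :: "nat \<Rightarrow> real \<Rightarrow> nat \<Rightarrow> nat list" where
  "digit_word b x i = map (digit b x) [1..<Suc i]"

lemma digit_word_simps: "length (digit_word b x i) = i"
  "b \<ge> 2 \<Longrightarrow> digit_word b x i \<in> lists {..<b}"
  by (auto simp: digit_word_def digit_less)

lemma scramble_digit_word: "scramble_digit b \<sigma> x (Suc i) = \<sigma> (digit_word b x i) (digit b x (Suc i))"
  by (simp add: scramble_digit_def digit_word_def)

primrec scramble_prefix :: "nat \<Rightarrow> (nat list \<Rightarrow> nat \<Rightarrow> nat) \<Rightarrow> real \<Rightarrow> nat \<Rightarrow> nat" where
  "scramble_prefix b \<sigma> x 0 = 0"
| "scramble_prefix b \<sigma> x (Suc k) = b * scramble_prefix b \<sigma> x k + scramble_digit b \<sigma> x (Suc k)"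

text \<open>Digits are counted from 0 at the most significant end of a \<open>K\<close>-digit
  number, in the order in which scrambling produces them.\<close>

definition int_digit :: "nat \<Rightarrow> nat \<Rightarrow> nat \<Rightarrow> nat \<Rightarrow> nat" where
  "int_digit b K c i = c div b ^ (K - Suc i) mod b"

lemma mult_add_eq_iff_div_mod: "s < b \<Longrightarrow> b * q + s = c \<longleftrightarrow> q = c div b \<and> s = (c mod b :: nat)"
  by (metis add.commute div_mult_self4 div_less add.right_neutral mod_less mod_mult_self4 mult.commute
      mult_div_mod_eq bot_nat_0.extremum_strict)

lemma scramble_prefix_eq_iff:
  assumes d: "\<And>i. scramble_digit b \<sigma> x (Suc i) < b" and c: "c < b ^ K"
  shows "scramble_prefix b \<sigma> x K = c \<longleftrightarrow> (\<forall>i<K. scramble_digit b \<sigma> x (Suc i) = int_digit b K c i)"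
  using c
proof (induction K arbitrary: c)
  case (Suc K)
  have "c div b < b ^ K" using Suc.prems by (intro less_mult_imp_div_less) (simp add: mult.commute)
  note IH = Suc.IH[OF this]
  have dig: "int_digit b (Suc K) c i = int_digit b K (c div b) i" if "i < K" for i
    using that pow_diff_Suc[OF that, of b] by (simp add: int_digit_def div_mult2_eq)
  have "scramble_prefix b \<sigma> x (Suc K) = c \<longleftrightarrow>
      scramble_prefix b \<sigma> x K = c div b \<and> scramble_digit b \<sigma> x (Suc K) = c mod b"
    by (simp only: scramble_prefix.simps mult_add_eq_iff_div_mod[OF d])
  also have "\<dots> \<longleftrightarrow> (\<forall>i<K. scramble_digit b \<sigma> x (Suc i) = int_digit b (Suc K) c i) \<and>
      scramble_digit b \<sigma> x (Suc K) = int_digit b (Suc K) c K"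
    unfolding IH using dig by (simp add: int_digit_def[of b "Suc K" c K])
  finally show ?case by (simp only: All_less_Suc conj_commute)
qed simp

lemma int_digits_agree_iff:
  assumes cd: "c < b ^ K" "d < b ^ K" and l: "l \<le> K"
  shows "(\<forall>i<l. int_digit b K c i = int_digit b K d i) \<longleftrightarrow> c div b ^ (K - l) = d div b ^ (K - l)"
  using l
proof (induction l)
  case (Suc l)
  then have l: "l < K" by simp
  have step: "z div b ^ (K - l) = z div b ^ (K - Suc l) div b" for z
    unfolding pow_diff_Suc[OF l] by (simp only: div_mult2_eq mult.commute[of b])
  have eq: "q = q' \<longleftrightarrow> q div b = q' div b \<and> q mod b = q' mod b" for q q' :: nat
    by (metis mult_div_mod_eq)
  have "(\<forall>i<Suc l. int_digit b K c i = int_digit b K d i) \<longleftrightarrow>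
      c div b ^ (K - l) = d div b ^ (K - l) \<and> int_digit b K c l = int_digit b K d l"
    using Suc by (simp add: All_less_Suc conj_commute)
  also have "\<dots> \<longleftrightarrow> c div b ^ (K - Suc l) = d div b ^ (K - Suc l)"
    unfolding step int_digit_def by (rule eq[symmetric])
  finally show ?case .
qed (use cd in simp)

text \<open>The joint law, in one coordinate, of the scrambled \<open>K\<close>-digit prefixes of
  two points with exactly \<open>l\<close> common digits: uniform on all pairs with exactly
  \<open>l\<close> common digits, of which there are
  \<open>b ^ K * (b - 1) * b ^ (K - Suc l)\<close>.\<close>

definition pair_mass :: "nat \<Rightarrow> nat \<Rightarrow> nat \<Rightarrow> nat \<times> nat \<Rightarrow> real" where
  "pair_mass b K l z =
     (if fst z div b ^ (K - l) = snd z div b ^ (K - l) \<and>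
         fst z div b ^ (K - Suc l) \<noteq> snd z div b ^ (K - Suc l)
      then real b ^ Suc l / (real b ^ (2 * K) * (real b - 1)) else 0)"

text \<open>The first product runs over the permutations met by the first point, the second over
  those met by the second point alone. At level \<open>l\<close> one shared permutation acts on two
  different digits, whence the \<open>b * (b - 1)\<close> equally likely values.\<close>

lemma pair_mass_digits:
  assumes b: "b \<ge> 2" and l: "l < K" and cd: "c < b ^ K" "d < b ^ K"
  shows "(\<Prod>i<K. if i < l then if int_digit b K c i = int_digit b K d i then 1 / real b else 0
            else if i = l then if int_digit b K c i \<noteq> int_digit b K d i then 1 / (real b * (real b - 1)) else 0
            else 1 / real b) * (\<Prod>i\<in>{l<..<K}. 1 / real b) = pair_mass b K l (c, d)"
    (is "prod ?f _ * _ = _")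
proof -
  define f where "f = ?f"
  have "{..<K} = {..<l} \<union> ({l} \<union> {l<..<K})" using l by auto
  then have "prod f {..<K} = prod f ({..<l} \<union> ({l} \<union> {l<..<K}))" by (rule arg_cong)
  also have "\<dots> = prod f {..<l} * prod f ({l} \<union> {l<..<K})"
    by (rule prod.union_disjoint) auto
  also have "prod f ({l} \<union> {l<..<K}) = f l * prod f {l<..<K}" by simp
  also have "prod f {l<..<K} = (\<Prod>i\<in>{l<..<K}. 1 / real b)" unfolding f_def by (intro prod.cong) auto
  also have "prod f {..<l} = (if \<forall>i<l. int_digit b K c i = int_digit b K d i then 1 / real b ^ l else 0)"
    unfolding f_def by (auto simp: power_one_over intro!: prod_zero)
  also have "f l = (if int_digit b K c l \<noteq> int_digit b K d l then 1 / (real b * (real b - 1)) else 0)"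
    by (simp add: f_def)
  finally have 1: "prod f {..<K} * (\<Prod>i\<in>{l<..<K}. 1 / real b) =
      (if \<forall>i<l. int_digit b K c i = int_digit b K d i then 1 / real b ^ l else 0) *
      (if int_digit b K c l \<noteq> int_digit b K d l then 1 / (real b * (real b - 1)) else 0) *
      (1 / real b ^ (K - Suc l) * (1 / real b ^ (K - Suc l)))"
    by (simp add: power_one_over)
  obtain e where e: "K = Suc l + e" using l less_iff_Suc_add by auto
  have 2: "1 / real b ^ l * (1 / (real b * (real b - 1))) * (1 / real b ^ (K - Suc l) * (1 / real b ^ (K - Suc l))) =
      real b ^ Suc l / (real b ^ (2 * K) * (real b - 1))"
    using b unfolding e by (simp add: field_simps power_add power_mult power2_eq_square)
  have 3: "(\<forall>i<l. int_digit b K c i = int_digit b K d i) \<longleftrightarrow> c div b ^ (K - l) = d div b ^ (K - l)"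
    by (rule int_digits_agree_iff[OF cd]) (use l in simp)
  have 4: "(\<forall>i<l. int_digit b K c i = int_digit b K d i) \<and> int_digit b K c l = int_digit b K d l \<longleftrightarrow>
      c div b ^ (K - Suc l) = d div b ^ (K - Suc l)"
    using int_digits_agree_iff[OF cd, of "Suc l"] l by (simp only: All_less_Suc Suc_leI conj_commute)
  have gen: "(if Q then r else 0) * (if \<not> R then s else 0) * t = (if Q \<and> \<not> (Q \<and> R) then r * s * t else 0)"
    for Q R and r s t :: real by simp
  show ?thesis unfolding 1[unfolded f_def] 2[symmetric] pair_mass_def fst_conv snd_conv 3[symmetric] 4[symmetric]
    by (rule gen)
qed

text \<open>Passes from single values to product sets: the sum over all \<open>g\<close> of a
  product over coordinates factors by distributivity.\<close>

lemma (in prob_space) prob_in_finite_sets: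
  fixes Z :: "'s::finite \<Rightarrow> 'a \<Rightarrow> 'z"
  assumes S: "\<And>j. finite (S j)"
    and meas: "\<And>g. g \<in> PiE UNIV S \<Longrightarrow> {\<omega> \<in> space M. \<forall>j. Z j \<omega> = g j} \<in> events"
    and F: "\<And>g. g \<in> PiE UNIV S \<Longrightarrow> prob {\<omega> \<in> space M. \<forall>j. Z j \<omega> = g j} = (\<Prod>j\<in>UNIV. F j (g j))"
  shows "{\<omega> \<in> space M. \<forall>j. Z j \<omega> \<in> S j} \<in> events"
    and "prob {\<omega> \<in> space M. \<forall>j. Z j \<omega> \<in> S j} = (\<Prod>j\<in>UNIV. \<Sum>z\<in>S j. F j z)"
proof -
  have fin: "finite (PiE UNIV S)" using S by (intro finite_PiE) auto
  have eq: "{\<omega> \<in> space M. \<forall>j. Z j \<omega> \<in> S j} = (\<Union>g\<in>PiE UNIV S. {\<omega> \<in> space M. \<forall>j. Z j \<omega> = g j})"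
  proof (intro equalityI subsetI)
    fix \<omega> assume "\<omega> \<in> {\<omega> \<in> space M. \<forall>j. Z j \<omega> \<in> S j}"
    then show "\<omega> \<in> (\<Union>g\<in>PiE UNIV S. {\<omega> \<in> space M. \<forall>j. Z j \<omega> = g j})"
      by (intro UN_I[of "\<lambda>j. Z j \<omega>"]) auto
  qed auto
  show "{\<omega> \<in> space M. \<forall>j. Z j \<omega> \<in> S j} \<in> events"
    unfolding eq using fin meas by (intro sets.finite_UN) auto
  have "prob {\<omega> \<in> space M. \<forall>j. Z j \<omega> \<in> S j} = (\<Sum>g\<in>PiE UNIV S. prob {\<omega> \<in> space M. \<forall>j. Z j \<omega> = g j})"
    unfolding eq
  proof (rule finite_measure_finite_Union)
    show "disjoint_family_on (\<lambda>g. {\<omega> \<in> space M. \<forall>j. Z j \<omega> = g j}) (PiE UNIV S)"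
      by (auto simp: disjoint_family_on_def fun_eq_iff)
  qed (use fin meas in auto)
  also have "\<dots> = (\<Sum>g\<in>PiE UNIV S. \<Prod>j\<in>UNIV. F j (g j))" using F by (intro sum.cong) auto
  also have "\<dots> = (\<Prod>j\<in>UNIV. \<Sum>z\<in>S j. F j z)" using S by (intro prod_sum_PiE[symmetric]) auto
  finally show "prob {\<omega> \<in> space M. \<forall>j. Z j \<omega> \<in> S j} = (\<Prod>j\<in>UNIV. \<Sum>z\<in>S j. F j z)" .
qed

locale nested_scrambling = prob_space M for M :: "'w measure" +
  fixes b :: nat and \<pi> :: "'s::finite \<Rightarrow> nat list \<Rightarrow> 'w \<Rightarrow> nat \<Rightarrow> nat"
  assumes perms: "nested_uniform_perms M b \<pi>" and b: "b \<ge> 2"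
begin

lemma perm_measurable:
  assumes "w \<in> lists {..<b}"
  shows "\<pi> j w \<in> measurable M (count_space (digit_perms b))"
proof -
  have "indep_vars (\<lambda>_. count_space (digit_perms b)) (\<lambda>(j, w). \<pi> j w) (UNIV \<times> lists {..<b})"
    using perms by (simp add: nested_uniform_perms_def)
  then have "(\<lambda>(j, w). \<pi> j w) (j, w) \<in> measurable M (count_space (digit_perms b))"
    using assms unfolding indep_vars_def by blast
  then show ?thesis by simp
qed

lemma perm_permutes: "w \<in> lists {..<b} \<Longrightarrow> \<omega> \<in> space M \<Longrightarrow> \<pi> j w \<omega> permutes {..<b}"
  using measurable_space[OF perm_measurable] by fastforce

lemma card_digit_perms: "card (digit_perms b) = fact b" "finite (digit_perms b)"
  by (simp_all add: card_permutations finite_permutations)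

lemma prob_perm:
  assumes "w \<in> lists {..<b}" "E \<subseteq> digit_perms b"
  shows "prob (\<pi> j w -` E \<inter> space M) = card E / fact b"
proof -
  have "prob (\<pi> j w -` E \<inter> space M) = measure (distr M (count_space (digit_perms b)) (\<pi> j w)) E"
    using perm_measurable[OF assms(1)] assms(2) by (subst measure_distr) auto
  also have "distr M (count_space (digit_perms b)) (\<pi> j w) = uniform_count_measure (digit_perms b)"
    using perms assms(1) by (simp add: nested_uniform_perms_def)
  also have "measure \<dots> E = card E / fact b"
    using assms(2) card_digit_perms by (subst measure_uniform_count_measure) auto
  finally show ?thesis .
qed

text \<open>The map \<open>h\<close> names the permutations by coordinate and word; injectivity
  guarantees that no permutation is used twice, so independence gives a product.\<close>

lemma prob_perms:
  assumes I: "finite I" "inj_on h I" "\<And>i. i \<in> I \<Longrightarrow> snd (h i) \<in> lists {..<b}"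
    and E: "\<And>i. i \<in> I \<Longrightarrow> E i \<subseteq> digit_perms b"
  shows "{\<omega> \<in> space M. \<forall>i\<in>I. \<pi> (fst (h i)) (snd (h i)) \<omega> \<in> E i} \<in> events"
    and "prob {\<omega> \<in> space M. \<forall>i\<in>I. \<pi> (fst (h i)) (snd (h i)) \<omega> \<in> E i} = (\<Prod>i\<in>I. card (E i) / fact b)"
proof -
  let ?X = "\<lambda>i. \<pi> (fst (h i)) (snd (h i))"
  show "{\<omega> \<in> space M. \<forall>i\<in>I. ?X i \<omega> \<in> E i} \<in> events"
  proof (rule sets.sets_Collect_finite_All[OF _ I(1)])
    fix i assume i: "i \<in> I"
    have "?X i -` E i \<inter> space M \<in> events"
      by (rule measurable_sets[OF perm_measurable[OF I(3)[OF i]]]) (use E[OF i] in auto)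
    moreover have "?X i -` E i \<inter> space M = {\<omega> \<in> space M. ?X i \<omega> \<in> E i}" by auto
    ultimately show "{\<omega> \<in> space M. ?X i \<omega> \<in> E i} \<in> events" by simp
  qed
  show "prob {\<omega> \<in> space M. \<forall>i\<in>I. ?X i \<omega> \<in> E i} = (\<Prod>i\<in>I. card (E i) / fact b)"
  proof (cases "I = {}")
    case False
    \<comment> \<open>Independence is stated over the names, the events over \<open>I\<close>;
      \<open>Y\<close> transports them along \<open>h\<close>.\<close>
    define Y where "Y = (\<lambda>z. E (the_inv_into I h z))"
    have Y: "Y (h i) = E i" if "i \<in> I" for i using that I(2) by (simp add: Y_def the_inv_into_f_f)
    have ind: "indep_vars (\<lambda>_. count_space (digit_perms b)) (\<lambda>(j, w). \<pi> j w) (UNIV \<times> lists {..<b})"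
      using perms by (simp add: nested_uniform_perms_def)
    have "{\<omega> \<in> space M. \<forall>i\<in>I. ?X i \<omega> \<in> E i} =
        (\<Inter>z\<in>h ` I. (\<lambda>(j, w). \<pi> j w) z -` Y z \<inter> space M)"
      using False Y by (auto simp: case_prod_unfold)
    also have "prob \<dots> = (\<Prod>z\<in>h ` I. prob ((\<lambda>(j, w). \<pi> j w) z -` Y z \<inter> space M))"
    proof (rule indep_varsD[OF ind])
      show "h ` I \<subseteq> UNIV \<times> lists {..<b}" 
        by (rule image_subsetI) (simp only: mem_Times_iff UNIV_I I(3) simp_thms)
      show "Y z \<in> sets (count_space (digit_perms b))" if "z \<in> h ` I" for z
      proof -
        from that obtain i where "i \<in> I" "z = h i" by blast
        then show ?thesis using Y E by simp
      qed
    qed (use I(1) False in auto)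
    also have "\<dots> = (\<Prod>i\<in>I. prob (?X i -` E i \<inter> space M))"
      using I(2) Y by (simp add: prod.reindex case_prod_unfold)
    also have "\<dots> = (\<Prod>i\<in>I. card (E i) / fact b)"
      using prob_perm[OF I(3) E] by (intro prod.cong) auto
    finally show ?thesis .
  qed (simp add: prob_space)
qed

lemma scramble_digit_less:
  "\<omega> \<in> space M \<Longrightarrow> scramble_digit b (\<lambda>w. \<pi> j w \<omega>) x (Suc i) < b"
  using permutes_in_image[OF perm_permutes[OF digit_word_simps(2)[OF b]], of \<omega> j x i "digit b x (Suc i)"]
    digit_less[OF b] by (simp add: scramble_digit_word)

abbreviation "X K x j \<omega> \<equiv> scramble_prefix b (\<lambda>w. \<pi> j w \<omega>) x K"

lemma fact_ratio: "fact (b - 1) / fact b = 1 / real b" "fact (b - 2) / fact b = 1 / (real b * (real b - 1))"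
proof -
  have f1: "fact b = real b * fact (b - 1)" using b by (simp add: fact_reduce)
  have f2: "fact (b - 1) = (real b - 1) * fact (b - 2)"
    using b fact_reduce[of "b - 1", where ?'a = real] by (simp add: of_nat_diff numeral_2_eq_2)
  show "fact (b - 1) / fact b = 1 / real b" unfolding f1 by simp
  show "fact (b - 2) / fact b = 1 / (real b * (real b - 1))" unfolding f1 f2 by simp
qed

text \<open>The permutations along one digit path belong to words of different lengths, hence are
  distinct. Each independently sends its digit to the prescribed value with probability
  \<open>1 / b\<close>.\<close>

lemma prob_prefix:
  assumes c: "\<And>j. c j < b ^ K"
  shows "{\<omega> \<in> space M. \<forall>j. X K (x j) j \<omega> = c j} \<in> events"
    and "prob {\<omega> \<in> space M. \<forall>j. X K (x j) j \<omega> = c j} = (\<Prod>j\<in>(UNIV::'s set). 1 / real b ^ K)"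
proof -
  define h where "h = (\<lambda>(j::'s, i). (j, digit_word b (x j) i))"
  define E where "E = (\<lambda>(j, i). {p. p permutes {..<b} \<and> p (digit b (x j) (Suc i)) = int_digit b K (c j) i})"
  let ?I = "UNIV \<times> {..<K} :: ('s \<times> nat) set"
  have eq: "{\<omega> \<in> space M. \<forall>j. X K (x j) j \<omega> = c j} =
      {\<omega> \<in> space M. \<forall>i\<in>?I. \<pi> (fst (h i)) (snd (h i)) \<omega> \<in> E i}"
    using scramble_digit_less perm_permutes[OF digit_word_simps(2)[OF b]]
    by (intro Collect_cong conj_cong refl)
      (auto simp: scramble_prefix_eq_iff[OF scramble_digit_less c] scramble_digit_word h_def E_def)
  have inj: "inj_on h ?I"
    by (rule inj_onI) (auto simp: h_def dest: arg_cong[where f = length] simp: digit_word_simps(1))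
  have I: "finite ?I" "\<And>i. i \<in> ?I \<Longrightarrow> snd (h i) \<in> lists {..<b}" "\<And>i. i \<in> ?I \<Longrightarrow> E i \<subseteq> digit_perms b"
    unfolding h_def E_def case_prod_unfold snd_conv
    by (simp, rule digit_word_simps(2)[OF b], auto)
  show "{\<omega> \<in> space M. \<forall>j. X K (x j) j \<omega> = c j} \<in> events"
    unfolding eq by (rule prob_perms(1)[OF I(1) inj I(2,3)])
  have "prob {\<omega> \<in> space M. \<forall>j. X K (x j) j \<omega> = c j} = (\<Prod>i\<in>?I. card (E i) / fact b)"
    unfolding eq by (rule prob_perms(2)[OF I(1) inj I(2,3)])
  also have "\<dots> = (\<Prod>i\<in>?I. 1 / real b)"
  proof (rule prod.cong)
    fix i
    have "card (E i) = fact (b - 1)" unfolding E_def case_prod_unfold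
      using card_permutes_fix1[of "{..<b}"] digit_less[OF b] b by (simp add: int_digit_def)
    then show "card (E i) / fact b = 1 / real b" using fact_ratio(1) by simp
  qed simp
  also have "\<dots> = (\<Prod>j\<in>(UNIV::'s set). 1 / real b ^ K)"
    by (simp add: power_mult[symmetric] power_one_over mult.commute)
  finally show "prob {\<omega> \<in> space M. \<forall>j. X K (x j) j \<omega> = c j} = (\<Prod>j\<in>(UNIV::'s set). 1 / real b ^ K)" .
qed


text \<open>Up to level \<open>l j\<close> the two points use the same permutation in coordinate \<open>j\<close>, afterwards distinct ones;
  hence the two-part index set in the proof.\<close>

lemma prob_prefix_pair:
  assumes xy: "\<And>j. 0 \<le> x j" "\<And>j. x j < 1" "\<And>j. 0 \<le> y j" "\<And>j. y j < 1"
    and l: "\<And>j k. cell_index b k (x j) = cell_index b k (y j) \<longleftrightarrow> k \<le> l j" "\<And>j. l j < K"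
    and c: "\<And>j. c j < b ^ K" "\<And>j. d j < b ^ K"
  shows "{\<omega> \<in> space M. \<forall>j. (X K (x j) j \<omega>, X K (y j) j \<omega>) = (c j, d j)} \<in> events"
    and "prob {\<omega> \<in> space M. \<forall>j. (X K (x j) j \<omega>, X K (y j) j \<omega>) = (c j, d j)} =
      (\<Prod>j\<in>(UNIV::'s set). pair_mass b K (l j) (c j, d j))"
proof -
  define h where "h = case_sum (\<lambda>(j::'s, i). (j, digit_word b (x j) i)) (\<lambda>(j, i). (j, digit_word b (y j) i))"
  \<comment> \<open>At a shared level a single permutation has to meet the requirements of both
    points.\<close>
  define EL where "EL = (\<lambda>j i. {p. p permutes {..<b} \<and> p (digit b (x j) (Suc i)) = int_digit b K (c j) i \<and>
      (i \<le> l j \<longrightarrow> p (digit b (y j) (Suc i)) = int_digit b K (d j) i)})"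
  define ER where "ER = (\<lambda>j i. {p. p permutes {..<b} \<and> p (digit b (y j) (Suc i)) = int_digit b K (d j) i})"
  define E where "E = case_sum (\<lambda>(j, i). EL j i) (\<lambda>(j, i). ER j i)"
  let ?IL = "SIGMA j:(UNIV::'s set). {..<K}"
  let ?IR = "SIGMA j:(UNIV::'s set). {l j<..<K}"
  let ?I = "?IL <+> ?IR"
  have word: "digit_word b (x j) i = digit_word b (y j) i \<longleftrightarrow> i \<le> l j" for i j
    unfolding digit_word_def digit_words_eq_iff[OF b xy] by (rule l(1))
  note less = digit_less[OF b]
  have pw: "\<pi> j (digit_word b z i) \<omega> permutes {..<b}" if "\<omega> \<in> space M" for j z i \<omega>
    by (rule perm_permutes[OF digit_word_simps(2)[OF b] that])
  have ev: "(\<forall>j. (X K (x j) j \<omega>, X K (y j) j \<omega>) = (c j, d j)) \<longleftrightarrow>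
      (\<forall>i\<in>?I. \<pi> (fst (h i)) (snd (h i)) \<omega> \<in> E i)" if w: "\<omega> \<in> space M" for \<omega>
  proof -
    have "(\<forall>j. (X K (x j) j \<omega>, X K (y j) j \<omega>) = (c j, d j)) \<longleftrightarrow>
       (\<forall>j. \<forall>i<K. \<pi> j (digit_word b (x j) i) \<omega> (digit b (x j) (Suc i)) = int_digit b K (c j) i \<and>
         \<pi> j (digit_word b (y j) i) \<omega> (digit b (y j) (Suc i)) = int_digit b K (d j) i)"
      by (auto simp: scramble_prefix_eq_iff[OF scramble_digit_less[OF w] c(1)]
          scramble_prefix_eq_iff[OF scramble_digit_less[OF w] c(2)] scramble_digit_word)
    also have "\<dots> \<longleftrightarrow> (\<forall>j. \<forall>i<K. \<pi> j (digit_word b (x j) i) \<omega> \<in> EL j i) \<and>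
        (\<forall>j. \<forall>i. l j < i \<and> i < K \<longrightarrow> \<pi> j (digit_word b (y j) i) \<omega> \<in> ER j i)"
    proof -
      have "(\<pi> j (digit_word b (x j) i) \<omega> (digit b (x j) (Suc i)) = int_digit b K (c j) i \<and>
         \<pi> j (digit_word b (y j) i) \<omega> (digit b (y j) (Suc i)) = int_digit b K (d j) i) \<longleftrightarrow>
         \<pi> j (digit_word b (x j) i) \<omega> \<in> EL j i \<and>
         (l j < i \<longrightarrow> \<pi> j (digit_word b (y j) i) \<omega> \<in> ER j i)" for j i
        using pw[OF w] word[of j i] by (cases "i \<le> l j") (auto simp: EL_def ER_def)
      then show ?thesis by blast
    qed
    also have "\<dots> \<longleftrightarrow> (\<forall>i\<in>?I. \<pi> (fst (h i)) (snd (h i)) \<omega> \<in> E i)"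
      by (force simp: h_def E_def)
    finally show ?thesis .
  qed
  then have eq: "{\<omega> \<in> space M. \<forall>j. (X K (x j) j \<omega>, X K (y j) j \<omega>) = (c j, d j)} =
      {\<omega> \<in> space M. \<forall>i\<in>?I. \<pi> (fst (h i)) (snd (h i)) \<omega> \<in> E i}" by blast
  have len: "i = i'" if "digit_word b z i = digit_word b z' i'" for z z' i i'
    using that by (metis digit_word_simps(1))
  have inj: "inj_on h ?I"
  proof (rule inj_onI)
    fix p q assume pq: "p \<in> ?I" "q \<in> ?I" "h p = h q"
    show "p = q"
    proof (cases p; cases q)
      fix p' q' assume "p = Inl p'" "q = Inl q'"
      then show ?thesis using pq(3) by (auto simp: h_def case_prod_unfold prod_eq_iff dest: len)
    next
      fix p' q' assume "p = Inr p'" "q = Inr q'"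
      then show ?thesis using pq(3) by (auto simp: h_def case_prod_unfold prod_eq_iff dest: len)
    next
      \<comment> \<open>Equal words have equal length, so they would be a common prefix longer than
        \<open>l\<close> allows at the levels of the right part.\<close>
      fix p' q' assume p: "p = Inl p'" and q: "q = Inr q'"
      then have e: "fst p' = fst q'" "digit_word b (x (fst p')) (snd p') = digit_word b (y (fst q')) (snd q')"
        using pq(3) by (auto simp: h_def case_prod_unfold)
      then have "snd p' = snd q'" using len by blast
      then have "snd q' \<le> l (fst q')" using e word by auto
      then show ?thesis using pq(2) q by auto
    next
      fix p' q' assume p: "p = Inr p'" and q: "q = Inl q'"
      then have e: "fst p' = fst q'" "digit_word b (x (fst q')) (snd q') = digit_word b (y (fst p')) (snd p')"
        using pq(3) by (auto simp: h_def case_prod_unfold)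
      then have "snd q' = snd p'" using len by blast
      then have "snd p' \<le> l (fst p')" using e word by auto
      then show ?thesis using pq(1) p by auto
    qed
  qed
  have I: "finite ?I" "\<And>i. i \<in> ?I \<Longrightarrow> snd (h i) \<in> lists {..<b}" "\<And>i. i \<in> ?I \<Longrightarrow> E i \<subseteq> digit_perms b"
  proof -
    show "finite ?I" by (intro finite_Plus finite_SigmaI) auto
    show "snd (h i) \<in> lists {..<b}" for i
      unfolding h_def case_prod_unfold
      by (cases i) (simp_all only: sum.case snd_conv digit_word_simps(2)[OF b])
    show "E i \<subseteq> digit_perms b" for i
      by (cases i) (auto simp: E_def EL_def ER_def)
  qed
  show "{\<omega> \<in> space M. \<forall>j. (X K (x j) j \<omega>, X K (y j) j \<omega>) = (c j, d j)} \<in> events"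
    unfolding eq by (rule prob_perms(1)[OF I(1) inj I(2,3)])
  have tl: "int_digit b K z i \<in> {..<b}" for z i using b by (simp add: int_digit_def)
  have EL: "card (EL j i) / fact b =
      (if i < l j then if int_digit b K (c j) i = int_digit b K (d j) i then 1 / real b else 0
       else if i = l j then if int_digit b K (c j) i \<noteq> int_digit b K (d j) i then 1 / (real b * (real b - 1)) else 0
       else 1 / real b)" for j i
  proof -
    have dig: "digit b (x j) (Suc i) = digit b (y j) (Suc i) \<longleftrightarrow> i < l j" if "i \<le> l j"
      using cell_index_Suc_eq_iff[OF b xy(1)[of j] xy(3)[of j], of i] l(1)[of "Suc i" j] l(1)[of i j] that by (simp add: Suc_le_eq)
    consider "i < l j" | "i = l j" | "l j < i" by linarith
    then show ?thesis
    proof cases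
      case 1
      then have dg: "digit b (y j) (Suc i) = digit b (x j) (Suc i)" using dig by simp
      show ?thesis
      proof (cases "int_digit b K (c j) i = int_digit b K (d j) i")
        case True
        then have "EL j i = {p. p permutes {..<b} \<and> p (digit b (x j) (Suc i)) = int_digit b K (c j) i}"
          using dg by (auto simp: EL_def)
        then show ?thesis using 1 True card_permutes_fix1[of "{..<b}" _ "int_digit b K (c j) i"] less tl fact_ratio(1)
          by simp
      next
        case False
        then have "EL j i = {}" using 1 dg by (auto simp: EL_def)
        then show ?thesis using 1 False by simp
      qed
    next
      case 2
      then have dg: "digit b (x j) (Suc i) \<noteq> digit b (y j) (Suc i)" using dig by simp
      show ?thesis
      proof (cases "int_digit b K (c j) i = int_digit b K (d j) i")
        case True
        have "EL j i = {}"
        proof (rule equals0I)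
          fix p assume "p \<in> EL j i"
          then have "p permutes {..<b}" "p (digit b (x j) (Suc i)) = p (digit b (y j) (Suc i))"
            using 2 True by (auto simp: EL_def)
          then show False using dg permutes_inj by (metis injD)
        qed
        then show ?thesis using 2 True by simp
      next
        case False
        then have "EL j i = {p. p permutes {..<b} \<and> p (digit b (x j) (Suc i)) = int_digit b K (c j) i \<and>
            p (digit b (y j) (Suc i)) = int_digit b K (d j) i}"
          using 2 by (auto simp: EL_def)
        also have "card \<dots> = fact (b - 2)"
          using card_permutes_fix2[OF _ _ _ dg tl tl False] less by simp
        finally show ?thesis using 2 False fact_ratio(2) by simp
      qed
    next
      case 3
      then have "EL j i = {p. p permutes {..<b} \<and> p (digit b (x j) (Suc i)) = int_digit b K (c j) i}"
        by (auto simp: EL_def)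
      then show ?thesis using 3 card_permutes_fix1[of "{..<b}" _ "int_digit b K (c j) i"] less tl fact_ratio(1)
        by simp
    qed
  qed
  have ER: "card (ER j i) / fact b = 1 / real b" for j i
    unfolding ER_def using card_permutes_fix1[of "{..<b}"] less tl fact_ratio(1) by simp
  have "prob {\<omega> \<in> space M. \<forall>j. (X K (x j) j \<omega>, X K (y j) j \<omega>) = (c j, d j)} =
      (\<Prod>i\<in>?I. card (E i) / fact b)"
    unfolding eq by (rule prob_perms(2)[OF I(1) inj I(2,3)])
  also have "\<dots> = (\<Prod>(j, i)\<in>?IL. card (EL j i) / fact b) * (\<Prod>(j, i)\<in>?IR. card (ER j i) / fact b)"
    by (subst prod.Plus) (simp_all add: E_def case_prod_unfold o_def)
  also have "\<dots> = (\<Prod>j\<in>UNIV. (\<Prod>i<K. card (EL j i) / fact b) * (\<Prod>i\<in>{l j<..<K}. card (ER j i) / fact b))"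
    by (subst (1 2) prod.Sigma[symmetric]) (simp_all add: prod.distrib)
  also have "\<dots> = (\<Prod>j\<in>UNIV. pair_mass b K (l j) (c j, d j))"
    unfolding EL ER pair_mass_digits[OF b l(2) c] ..
  finally show "prob {\<omega> \<in> space M. \<forall>j. (X K (x j) j \<omega>, X K (y j) j \<omega>) = (c j, d j)} =
      (\<Prod>j\<in>(UNIV::'s set). pair_mass b K (l j) (c j, d j))" .
qed

end

subsection \<open>Variance of the box estimator\<close>

text \<open>The diagonal contributes \<open>n * \<mu>\<close> to the second moment, with
  \<open>n = card P\<close>; by \<open>pairs\<close> the rest contributes at most what pairwise
  independent hits would.\<close>

lemma (in prob_space) variance_average_indicators_le:
  assumes P: "finite P" "P \<noteq> {}" and B: "\<And>u. u \<in> P \<Longrightarrow> B u \<in> events"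
    and \<mu>: "\<And>u. u \<in> P \<Longrightarrow> prob (B u) = \<mu>"
    and pairs: "(\<Sum>(u, v)\<in>{(u, v). u \<in> P \<and> v \<in> P \<and> u \<noteq> v}. prob (B u \<inter> B v)) \<le>
      real (card P) * (real (card P) - 1) * \<mu>\<^sup>2"
  shows "variance (\<lambda>\<omega>. (\<Sum>u\<in>P. indicator (B u) \<omega>) / real (card P)) \<le> \<mu> * (1 - \<mu>) / real (card P)"
proof -
  let ?n = "real (card P)"
  let ?S = "\<lambda>\<omega>. \<Sum>u\<in>P. indicator (B u) \<omega> :: real"
  let ?D = "{(u, v). u \<in> P \<and> v \<in> P \<and> u \<noteq> v}"
  have n: "?n > 0" using P by (simp add: card_gt_0_iff)
  have ind: "integrable M (indicator C :: 'a \<Rightarrow> real)" if "C \<in> events" for C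
    using that by (simp add: integrable_indicator_iff emeasure_eq_measure)
  have intS: "integrable M ?S" using B by (intro Bochner_Integration.integrable_sum ind) auto
  have ES: "expectation ?S = ?n * \<mu>"
    using B \<mu> by (subst Bochner_Integration.integral_sum) (auto intro!: ind)
  have sq: "(?S \<omega>)\<^sup>2 = (\<Sum>(u, v)\<in>P \<times> P. indicator (B u \<inter> B v) \<omega>)" for \<omega>
    by (simp add: power2_eq_square sum_product sum.cartesian_product indicator_inter_arith)
  have intS2: "integrable M (\<lambda>\<omega>. (?S \<omega>)\<^sup>2)"
    unfolding sq case_prod_unfold using B by (intro Bochner_Integration.integrable_sum ind) auto
  have "expectation (\<lambda>\<omega>. (?S \<omega>)\<^sup>2) = (\<Sum>(u, v)\<in>P \<times> P. prob (B u \<inter> B v))"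
    unfolding sq case_prod_unfold using B
    by (subst Bochner_Integration.integral_sum) (auto intro!: ind sum.cong simp: Int_assoc sets.Int_space_eq2)
  also have "P \<times> P = (\<lambda>u. (u, u)) ` P \<union> ?D" by auto
  also have "(\<Sum>(u, v)\<in>\<dots>. prob (B u \<inter> B v)) =
      (\<Sum>(u, v)\<in>(\<lambda>u. (u, u)) ` P. prob (B u \<inter> B v)) + (\<Sum>(u, v)\<in>?D. prob (B u \<inter> B v))"
    by (rule sum.union_disjoint) (use P(1) in \<open>auto intro: finite_subset[of _ "P \<times> P"]\<close>)
  also have "(\<Sum>(u, v)\<in>(\<lambda>u. (u, u)) ` P. prob (B u \<inter> B v)) = ?n * \<mu>"
    by (subst sum.reindex) (auto simp: inj_on_def \<mu>)
  finally have ES2: "expectation (\<lambda>\<omega>. (?S \<omega>)\<^sup>2) \<le> ?n * \<mu> + ?n * (?n - 1) * \<mu>\<^sup>2"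
    using pairs by simp
  have "variance (\<lambda>\<omega>. ?S \<omega> / ?n) = expectation (\<lambda>\<omega>. (?S \<omega> / ?n)\<^sup>2) - (expectation (\<lambda>\<omega>. ?S \<omega> / ?n))\<^sup>2"
    using intS intS2 by (intro variance_eq) (auto simp: power_divide)
  also have "\<dots> = expectation (\<lambda>\<omega>. (?S \<omega>)\<^sup>2) / ?n\<^sup>2 - \<mu>\<^sup>2"
    using n by (simp add: power_divide ES)
  also have "\<dots> \<le> (?n * \<mu> + ?n * (?n - 1) * \<mu>\<^sup>2) / ?n\<^sup>2 - \<mu>\<^sup>2"
    using ES2 n by (intro diff_right_mono divide_right_mono) auto
  also have "\<dots> = \<mu> * (1 - \<mu>) / ?n"
    using n by (simp add: field_simps power2_eq_square)
  finally show ?thesis .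
qed

section \<open>Volume of boxes and bounds from digit prefixes\<close>

lemma half_open_box_measurable: "half_open_box lo hi \<in> sets borel"
proof -
  have "half_open_box lo hi = (\<Inter>j. {x. lo $ j \<le> x $ j} \<inter> {x. x $ j < hi $ j})"
    by (auto simp: half_open_box_def)
  also have "\<dots> \<in> sets borel"
    by (intro sets.finite_INT sets.Int borel_closed[OF closed_Collect_le]
        borel_open[OF open_Collect_less] continuous_intros) auto
  finally show ?thesis .
qed

text \<open>Squeezed between the open and the closed box with the same corners.\<close>

lemma measure_half_open_box:
  assumes "\<And>j. lo $ j \<le> hi $ j"
  shows "measure lborel (half_open_box lo hi :: (real ^ 's::finite) set) = (\<Prod>j\<in>UNIV. hi $ j - lo $ j)"
proof (rule antisym)
  have ne: "cbox lo hi \<noteq> {}" using assms by (auto simp: interval_ne_empty_cart)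
  have c: "measure lborel (cbox lo hi) = (\<Prod>j\<in>UNIV. hi $ j - lo $ j)"
    by (rule content_cbox_cart[OF ne])
  have fm: "half_open_box lo hi \<in> fmeasurable lborel"
    by (rule fmeasurableI2[of "cbox lo hi"])
      (use half_open_box_measurable in \<open>auto simp: half_open_box_def mem_box_cart less_imp_le\<close>)
  have "measure lborel (half_open_box lo hi) \<le> measure lborel (cbox lo hi)"
    by (rule measure_mono_fmeasurable)
      (use half_open_box_measurable in \<open>auto simp: half_open_box_def mem_box_cart less_imp_le\<close>)
  then show "measure lborel (half_open_box lo hi) \<le> (\<Prod>j\<in>UNIV. hi $ j - lo $ j)" using c by simp
  have "measure lborel (box lo hi) \<le> measure lborel (half_open_box lo hi)"
    by (rule measure_mono_fmeasurable[OF _ _ fm])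
      (auto simp: half_open_box_def mem_box_cart less_imp_le)
  then show "(\<Prod>j\<in>UNIV. hi $ j - lo $ j) \<le> measure lborel (half_open_box lo hi)"
    using assms by (simp add: c[symmetric] measure_lborel_box_eq measure_lborel_cbox_eq)
qed

lemma sum_pair_mass:
  assumes b: "b \<ge> 2" and l: "l < K" and q: "q \<le> b ^ K"
  shows "(\<Sum>z\<in>{p..<q} \<times> {p..<q}. pair_mass b K l z) = (\<Sum>k\<le>l. real b ^ k * interval_weight b K p q k)"
proof -
  define S where "S = (\<lambda>k. {(c, d). c \<in> {p..<q} \<and> d \<in> {p..<q} \<and> c div b ^ (K - k) = d div b ^ (K - k)})"
  define r where "r = real b ^ Suc l / (real b ^ (2 * K) * (real b - 1))"
  have fin: "finite (S k)" for k
    by (rule finite_subset[of _ "{p..<q} \<times> {p..<q}"]) (auto simp: S_def)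
  have sub: "S (Suc l) \<subseteq> S l"
  proof -
    have "c div b ^ (K - l) = d div b ^ (K - l)" if "c div b ^ (K - Suc l) = d div b ^ (K - Suc l)" for c d
      unfolding pow_diff_Suc[OF l] mult.commute[of b] div_mult2_eq that ..
    then show ?thesis unfolding S_def by blast
  qed
  have "(\<Sum>z\<in>{p..<q} \<times> {p..<q}. pair_mass b K l z) = (\<Sum>z\<in>{p..<q} \<times> {p..<q}. if z \<in> S l - S (Suc l) then r else 0)"
    by (intro sum.cong refl) (simp add: pair_mass_def S_def r_def case_prod_unfold mem_Times_iff)
  also have "\<dots> = (\<Sum>z\<in>({p..<q} \<times> {p..<q}) \<inter> (S l - S (Suc l)). r)"
    by (rule sum.inter_restrict[symmetric]) simp
  also have "({p..<q} \<times> {p..<q}) \<inter> (S l - S (Suc l)) = S l - S (Suc l)"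
    unfolding S_def by blast
  also have "(\<Sum>z\<in>S l - S (Suc l). r) = real (card (S l) - card (S (Suc l))) * r"
    using sub fin by (simp add: card_Diff_subset)
  also have "real (card (S l) - card (S (Suc l))) = pairs_eq b K p q l"
    using pairs_ge_card[OF b _ q, of l p] pairs_ge_card[OF b _ q, of "Suc l" p] l card_mono[OF fin sub]
    by (simp add: pairs_eq_def S_def of_nat_diff)
  finally show ?thesis using sum_interval_weight_upto[OF b l, of p q] by (simp add: r_def)
qed

text \<open>The upper bound is not strict: if all later digits are \<open>b - 1\<close>, the value
  is the right end of the cell.\<close>

lemma scramble_coord_bounds:
  assumes b: "b \<ge> 2" and d: "\<And>i. scramble_digit b \<sigma> x (Suc i) < b"
  shows "real (scramble_prefix b \<sigma> x K) / real b ^ K \<le> scramble_coord b \<sigma> x"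
    and "scramble_coord b \<sigma> x \<le> (real (scramble_prefix b \<sigma> x K) + 1) / real b ^ K"
proof -
  let ?f = "\<lambda>i. real (scramble_digit b \<sigma> x (Suc i)) / real b ^ Suc i"
  let ?g = "\<lambda>i. (real b - 1) / real b ^ Suc i"
  have geo: "(\<lambda>i. ?g (i + K)) sums (1 / real b ^ K)"
  proof -
    have "(\<lambda>i. (1 / real b) ^ i) sums (1 / (1 - 1 / real b))"
      using b by (intro geometric_sums) simp
    then have "(\<lambda>i. (real b - 1) / real b ^ Suc K * (1 / real b) ^ i) sums
        ((real b - 1) / real b ^ Suc K * (1 / (1 - 1 / real b)))" by (rule sums_mult)
    moreover have "(real b - 1) / real b ^ Suc K * (1 / (1 - 1 / real b)) = 1 / real b ^ K"
      using b by (simp add: field_simps)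
    moreover have "(real b - 1) / real b ^ Suc K * (1 / real b) ^ i = ?g (i + K)" for i
      by (simp add: power_add power_one_over field_simps)
    ultimately show ?thesis by simp
  qed
  have le: "?f i \<le> ?g i" for i
    using d[of i] by (intro divide_right_mono) auto
  have nn: "0 \<le> ?f i" for i by simp
  have sg: "summable ?g" using geo summable_iff_shift[of ?g K] by (auto simp: sums_iff)
  have sf: "summable ?f" by (rule summable_comparison_test'[OF sg, of 0]) (use le in simp)
  have pre: "(\<Sum>i<K. ?f i) = real (scramble_prefix b \<sigma> x K) / real b ^ K"
    using b by (induction K) (simp_all add: field_simps)
  have split: "scramble_coord b \<sigma> x = (\<Sum>i. ?f (i + K)) + (\<Sum>i<K. ?f i)"
    unfolding scramble_coord_def by (rule suminf_split_initial_segment[OF sf])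
  have "0 \<le> (\<Sum>i. ?f (i + K))" by (intro suminf_nonneg nn summable_ignore_initial_segment sf)
  then show "real (scramble_prefix b \<sigma> x K) / real b ^ K \<le> scramble_coord b \<sigma> x"
    unfolding split pre by simp
  have "(\<Sum>i. ?f (i + K)) \<le> (\<Sum>i. ?g (i + K))"
    by (intro suminf_le summable_ignore_initial_segment sf sg le)
  also have "\<dots> = 1 / real b ^ K" using geo by (simp only: sums_iff)
  finally show "scramble_coord b \<sigma> x \<le> (real (scramble_prefix b \<sigma> x K) + 1) / real b ^ K"
    unfolding split pre by (simp add: add_divide_distrib)
qed

context nested_scrambling
begin

lemma prob_prefix_in:
  assumes "\<And>j. q j \<le> b ^ K"
  shows "{\<omega> \<in> space M. \<forall>j. X K (x j) j \<omega> \<in> {p j..<q j}} \<in> events"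
    and "prob {\<omega> \<in> space M. \<forall>j. X K (x j) j \<omega> \<in> {p j..<q j}} =
      (\<Prod>j\<in>(UNIV::'s set). real (q j - p j) / real b ^ K)"
proof -
  have c: "g j < b ^ K" if "g \<in> PiE UNIV (\<lambda>j. {p j..<q j})" for g :: "'s \<Rightarrow> nat" and j
    using PiE_mem[OF that, of j] assms[of j] by auto
  have ev: "{\<omega> \<in> space M. \<forall>j. X K (x j) j \<omega> = g j} \<in> events"
    and pr: "prob {\<omega> \<in> space M. \<forall>j. X K (x j) j \<omega> = g j} = (\<Prod>j\<in>(UNIV::'s set). 1 / real b ^ K)"
    if "g \<in> PiE UNIV (\<lambda>j. {p j..<q j})" for g
    by (fact prob_prefix[of g K x, OF c[OF that]])+
  note * = prob_in_finite_sets[where S = "\<lambda>j. {p j..<q j}" and Z = "\<lambda>j \<omega>. X K (x j) j \<omega>"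
      and F = "\<lambda>j z. 1 / real b ^ K", OF _ ev pr]
  show "{\<omega> \<in> space M. \<forall>j. X K (x j) j \<omega> \<in> {p j..<q j}} \<in> events" by (rule *(1)) simp
  have "prob {\<omega> \<in> space M. \<forall>j. X K (x j) j \<omega> \<in> {p j..<q j}} =
      (\<Prod>j\<in>UNIV. \<Sum>z\<in>{p j..<q j}. 1 / real b ^ K)" by (rule *(2)) simp
  then show "prob {\<omega> \<in> space M. \<forall>j. X K (x j) j \<omega> \<in> {p j..<q j}} =
      (\<Prod>j\<in>(UNIV::'s set). real (q j - p j) / real b ^ K)" by simp
qed

lemma prob_prefix_pair_in:
  assumes xy: "\<And>j. 0 \<le> x j" "\<And>j. x j < 1" "\<And>j. 0 \<le> y j" "\<And>j. y j < 1"
    and l: "\<And>j k. cell_index b k (x j) = cell_index b k (y j) \<longleftrightarrow> k \<le> l j" "\<And>j. l j < K"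
    and q: "\<And>j. q j \<le> b ^ K"
  shows "{\<omega> \<in> space M. \<forall>j. (X K (x j) j \<omega>, X K (y j) j \<omega>) \<in> {p j..<q j} \<times> {p j..<q j}} \<in> events"
    and "prob {\<omega> \<in> space M. \<forall>j. (X K (x j) j \<omega>, X K (y j) j \<omega>) \<in> {p j..<q j} \<times> {p j..<q j}} =
      (\<Prod>j\<in>(UNIV::'s set). \<Sum>k\<le>l j. real b ^ k * interval_weight b K (p j) (q j) k)"
proof -
  have c: "fst (g j) < b ^ K" "snd (g j) < b ^ K"
    if "g \<in> PiE UNIV (\<lambda>j. {p j..<q j} \<times> {p j..<q j})" for g :: "'s \<Rightarrow> nat \<times> nat" and j
    using PiE_mem[OF that, of j] q[of j] by (auto simp: mem_Times_iff)
  have ev: "{\<omega> \<in> space M. \<forall>j. (X K (x j) j \<omega>, X K (y j) j \<omega>) = g j} \<in> events"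
    and pr: "prob {\<omega> \<in> space M. \<forall>j. (X K (x j) j \<omega>, X K (y j) j \<omega>) = g j} =
      (\<Prod>j\<in>UNIV. pair_mass b K (l j) (g j))"
    if g: "g \<in> PiE UNIV (\<lambda>j. {p j..<q j} \<times> {p j..<q j})" for g
    by (fact prob_prefix_pair[of x y l K "\<lambda>j. fst (g j)" "\<lambda>j. snd (g j)", OF xy l c[OF g], unfolded prod.collapse])+
  note * = prob_in_finite_sets[where S = "\<lambda>j. {p j..<q j} \<times> {p j..<q j}"
      and Z = "\<lambda>j \<omega>. (X K (x j) j \<omega>, X K (y j) j \<omega>)" and F = "\<lambda>j z. pair_mass b K (l j) z",
      OF _ ev pr]
  show "{\<omega> \<in> space M. \<forall>j. (X K (x j) j \<omega>, X K (y j) j \<omega>) \<in> {p j..<q j} \<times> {p j..<q j}} \<in> events"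
    by (rule *(1)) simp
  have "prob {\<omega> \<in> space M. \<forall>j. (X K (x j) j \<omega>, X K (y j) j \<omega>) \<in> {p j..<q j} \<times> {p j..<q j}} =
      (\<Prod>j\<in>(UNIV::'s set). \<Sum>z\<in>{p j..<q j} \<times> {p j..<q j}. pair_mass b K (l j) z)"
    by (rule *(2)) simp
  then show "prob {\<omega> \<in> space M. \<forall>j. (X K (x j) j \<omega>, X K (y j) j \<omega>) \<in> {p j..<q j} \<times> {p j..<q j}} =
      (\<Prod>j\<in>(UNIV::'s set). \<Sum>k\<le>l j. real b ^ k * interval_weight b K (p j) (q j) k)"
    unfolding sum_pair_mass[OF b l(2) q] .
qed

lemma scramble_digit_measurable:
  "(\<lambda>\<omega>. real (scramble_digit b (\<lambda>w. \<pi> j w \<omega>) x (Suc i))) \<in> borel_measurable M"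
proof -
  have "(\<lambda>p. real (p (digit b x (Suc i)))) \<in> borel_measurable (count_space (digit_perms b))" by simp
  from measurable_compose[OF perm_measurable[OF digit_word_simps(2)[OF b]] this] show ?thesis
    by (simp add: scramble_digit_word)
qed

lemma scramble_coord_measurable: "(\<lambda>\<omega>. scramble_coord b (\<lambda>w. \<pi> j w \<omega>) x) \<in> borel_measurable M"
  unfolding scramble_coord_def
  by (intro borel_measurable_suminf borel_measurable_divide scramble_digit_measurable) simp

definition hit :: "real ^ 's \<Rightarrow> real ^ 's \<Rightarrow> real ^ 's \<Rightarrow> 'w set" where
  "hit lo hi u = {\<omega> \<in> space M. scramble_point b (\<lambda>j w. \<pi> j w \<omega>) u \<in> half_open_box lo hi}"

lemma hit_events: "hit lo hi u \<in> events"
proof -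
  have "hit lo hi u = {\<omega> \<in> space M. \<forall>j\<in>UNIV. lo $ j \<le> scramble_coord b (\<lambda>w. \<pi> j w \<omega>) (u $ j) \<and>
      scramble_coord b (\<lambda>w. \<pi> j w \<omega>) (u $ j) < hi $ j}"
    by (auto simp: hit_def half_open_box_def scramble_point_def)
  also have "\<dots> \<in> events"
    by (intro sets.sets_Collect_finite_All sets.sets_Collect_conj borel_measurable_le
        borel_measurable_less scramble_coord_measurable) simp_all
  finally show ?thesis .
qed

text \<open>A prefix \<open>c\<close> confines the coordinate to a closed cell, which reaches
  \<open>a\<close> or beyond as soon as \<open>c + 1 \<ge> a * b ^ K\<close>; hence the
  \<open>- 1\<close>. For \<open>a = 0\<close>, \<open>nat\<close> cuts the result off at 0.\<close>

definition outer_lo :: "nat \<Rightarrow> real \<Rightarrow> nat" where "outer_lo K a = nat (\<lceil>a * real b ^ K\<rceil> - 1)"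
definition outer_hi :: "nat \<Rightarrow> real \<Rightarrow> nat" where "outer_hi K a = nat \<lceil>a * real b ^ K\<rceil>"

lemma coord_bounds:
  assumes "\<omega> \<in> space M"
  shows "real (X K x j \<omega>) \<le> scramble_coord b (\<lambda>w. \<pi> j w \<omega>) x * real b ^ K"
    and "scramble_coord b (\<lambda>w. \<pi> j w \<omega>) x * real b ^ K \<le> real (X K x j \<omega>) + 1"
  using scramble_coord_bounds[OF b scramble_digit_less[OF assms], of j x K] b
  by (simp_all add: pos_divide_le_eq pos_le_divide_eq)

lemma hit_outer:
  assumes "\<omega> \<in> hit lo hi u"
  shows "X K (u $ j) j \<omega> \<in> {outer_lo K (lo $ j)..<outer_hi K (hi $ j)}"
proof -
  have w: "\<omega> \<in> space M" and c: "lo $ j \<le> scramble_coord b (\<lambda>w. \<pi> j w \<omega>) (u $ j)"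
    "scramble_coord b (\<lambda>w. \<pi> j w \<omega>) (u $ j) < hi $ j"
    using assms by (auto simp: hit_def half_open_box_def scramble_point_def)
  have "lo $ j * real b ^ K \<le> scramble_coord b (\<lambda>w. \<pi> j w \<omega>) (u $ j) * real b ^ K"
    using c by (intro mult_right_mono) auto
  then have "lo $ j * real b ^ K \<le> real (X K (u $ j) j \<omega>) + 1" using coord_bounds(2)[OF w] order_trans by blast
  then have "\<lceil>lo $ j * real b ^ K\<rceil> \<le> int (X K (u $ j) j \<omega>) + 1" by (simp add: ceiling_le_iff)
  then have 1: "outer_lo K (lo $ j) \<le> X K (u $ j) j \<omega>" by (simp add: outer_lo_def)
  have "scramble_coord b (\<lambda>w. \<pi> j w \<omega>) (u $ j) * real b ^ K < hi $ j * real b ^ K"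
    using c b by (intro mult_strict_right_mono) auto
  then have "real (X K (u $ j) j \<omega>) < hi $ j * real b ^ K" using coord_bounds(1)[OF w] le_less_trans by blast
  then have "int (X K (u $ j) j \<omega>) < \<lceil>hi $ j * real b ^ K\<rceil>" by (simp add: less_ceiling_iff)
  then have "X K (u $ j) j \<omega> < outer_hi K (hi $ j)" by (simp add: outer_hi_def)
  then show ?thesis using 1 by simp
qed

text \<open>Outer approximations with the roles of the two roundings exchanged are inner approximations.\<close>

lemma hit_inner:
  assumes w: "\<omega> \<in> space M"
    and X: "\<And>j. X K (u $ j) j \<omega> \<in> {outer_hi K (lo $ j)..<outer_lo K (hi $ j)}"
  shows "\<omega> \<in> hit lo hi u"
proof -
  have "lo $ j \<le> scramble_coord b (\<lambda>w. \<pi> j w \<omega>) (u $ j) \<and>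
      scramble_coord b (\<lambda>w. \<pi> j w \<omega>) (u $ j) < hi $ j" for j
  proof
    have "\<lceil>lo $ j * real b ^ K\<rceil> \<le> int (X K (u $ j) j \<omega>)" 
      using X[of j] unfolding outer_hi_def atLeastLessThan_iff nat_le_iff by (rule conjunct1)
    then have "lo $ j * real b ^ K \<le> real (X K (u $ j) j \<omega>)" by (simp add: ceiling_le_iff)
    also have "\<dots> \<le> scramble_coord b (\<lambda>w. \<pi> j w \<omega>) (u $ j) * real b ^ K" by (rule coord_bounds(1)[OF w])
    finally show "lo $ j \<le> scramble_coord b (\<lambda>w. \<pi> j w \<omega>) (u $ j)" using b by simp
    have "int (X K (u $ j) j \<omega>) + 1 < \<lceil>hi $ j * real b ^ K\<rceil>" 
      using X[of j] unfolding outer_lo_def atLeastLessThan_iff zless_nat_eq_int_zless by linarith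
    then have "real (X K (u $ j) j \<omega>) + 1 < hi $ j * real b ^ K" by (simp add: less_ceiling_iff)
    then have "scramble_coord b (\<lambda>w. \<pi> j w \<omega>) (u $ j) * real b ^ K < hi $ j * real b ^ K"
      using coord_bounds(2)[OF w] le_less_trans by blast
    then show "scramble_coord b (\<lambda>w. \<pi> j w \<omega>) (u $ j) < hi $ j" using b by simp
  qed
  then show ?thesis using w by (simp add: hit_def half_open_box_def scramble_point_def)
qed

lemma outer_bounds:
  assumes "0 \<le> a" "a \<le> 1"
  shows "outer_hi K a \<le> b ^ K"
    and "a * real b ^ K \<le> real (outer_hi K a)" "real (outer_hi K a) \<le> a * real b ^ K + 1"
    and "a * real b ^ K - 1 \<le> real (outer_lo K a)" "real (outer_lo K a) \<le> a * real b ^ K"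
    and "outer_lo K a \<le> outer_hi K a"
proof -
  let ?y = "a * real b ^ K"
  have y: "0 \<le> ?y" "?y \<le> real b ^ K" using assms by (auto simp: mult_left_le_one_le)
  have c: "?y \<le> of_int \<lceil>?y\<rceil>" "of_int \<lceil>?y\<rceil> < ?y + 1" "0 \<le> \<lceil>?y\<rceil>"
    using y ceiling_correct[of ?y] by linarith+
  have "\<lceil>?y\<rceil> \<le> int (b ^ K)" using y(2) by (simp add: ceiling_le_iff)
  then show "outer_hi K a \<le> b ^ K" by (simp add: outer_hi_def nat_le_iff)
  have h: "real (outer_hi K a) = of_int \<lceil>?y\<rceil>" using c(3) by (simp add: outer_hi_def)
  show "?y \<le> real (outer_hi K a)" "real (outer_hi K a) \<le> ?y + 1" unfolding h using c by linarith+
  have l: "real (outer_lo K a) = max 0 (of_int \<lceil>?y\<rceil> - 1)"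
    by (simp add: outer_lo_def max_def)
  show "?y - 1 \<le> real (outer_lo K a)" "real (outer_lo K a) \<le> ?y" unfolding l using c y by linarith+
  show "outer_lo K a \<le> outer_hi K a" by (simp add: outer_lo_def outer_hi_def)
qed

text \<open>Used with \<open>a = 2\<close> and \<open>a = -2\<close>, since rounding moves each end
  by at most one grid cell. The \<open>max 0\<close> keeps the factors nonnegative on coarse grids,
  as monotonicity of products requires.\<close>

lemma prod_tendsto_volume:
  fixes lo hi :: "real ^ 's"
  assumes "\<And>j. lo $ j \<le> hi $ j"
  shows "(\<lambda>K. \<Prod>j\<in>UNIV. max 0 (hi $ j - lo $ j + a / real b ^ K)) \<longlonglongrightarrow> (\<Prod>j\<in>UNIV. hi $ j - lo $ j)"
proof -
  have "(\<lambda>K. a * (1 / real b) ^ K) \<longlonglongrightarrow> a * 0"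
    by (intro tendsto_mult tendsto_const LIMSEQ_power_zero) (use b in simp)
  then have 0: "(\<lambda>K. a / real b ^ K) \<longlonglongrightarrow> 0" by (simp add: power_one_over)
  have "(\<lambda>K. \<Prod>j\<in>UNIV. max 0 (hi $ j - lo $ j + a / real b ^ K)) \<longlonglongrightarrow> (\<Prod>j\<in>UNIV. max 0 (hi $ j - lo $ j + 0))"
    by (intro tendsto_prod tendsto_max tendsto_add tendsto_const 0)
  then show ?thesis using assms by (simp add: max_def)
qed

text \<open>Prefixes are exactly uniform, so the probability lies between the volumes of an inner
  and an outer grid box, both of which tend to that of the box.\<close>

lemma prob_hit:
  assumes lh: "\<And>j. 0 \<le> lo $ j \<and> lo $ j < hi $ j \<and> hi $ j \<le> 1"
  shows "prob (hit lo hi u) = (\<Prod>j\<in>UNIV. hi $ j - lo $ j)"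
proof (rule antisym)
  have B: "real b ^ K > 0" for K using b by simp
  have lh': "0 \<le> lo $ j" "lo $ j \<le> 1" "0 \<le> hi $ j" "hi $ j \<le> 1" "lo $ j \<le> hi $ j" for j
    using lh[of j] by auto
  show "prob (hit lo hi u) \<le> (\<Prod>j\<in>UNIV. hi $ j - lo $ j)"
  proof (rule LIMSEQ_le_const[OF prod_tendsto_volume[of lo hi 2]], simp add: lh', intro exI[of _ 0] allI impI)
    fix K :: nat
    have "prob (hit lo hi u) \<le> prob {\<omega> \<in> space M. \<forall>j. X K (u $ j) j \<omega> \<in> {outer_lo K (lo $ j)..<outer_hi K (hi $ j)}}"
      by (intro finite_measure_mono prob_prefix_in(1) outer_bounds lh' subsetI CollectI conjI allI hit_outer)
        (auto simp: hit_def)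
    also have "\<dots> = (\<Prod>j\<in>UNIV. real (outer_hi K (hi $ j) - outer_lo K (lo $ j)) / real b ^ K)"
      by (intro prob_prefix_in(2) outer_bounds lh')
    also have "\<dots> \<le> (\<Prod>j\<in>UNIV. max 0 (hi $ j - lo $ j + 2 / real b ^ K))"
    proof (intro prod_mono conjI)
      fix j
      have "real (outer_hi K (hi $ j) - outer_lo K (lo $ j)) \<le> max 0 (hi $ j - lo $ j + 2 / real b ^ K) * real b ^ K"
      proof (cases "outer_lo K (lo $ j) \<le> outer_hi K (hi $ j)")
        case True
        then have "real (outer_hi K (hi $ j) - outer_lo K (lo $ j)) \<le> (hi $ j * real b ^ K + 1) - (lo $ j * real b ^ K - 1)"
          using outer_bounds(3)[OF lh'(3)[of j] lh'(4)[of j], of K] outer_bounds(4)[OF lh'(1)[of j] lh'(2)[of j], of K] by (simp add: of_nat_diff)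
        also have "\<dots> = (hi $ j - lo $ j + 2 / real b ^ K) * real b ^ K" using B[of K] by (simp add: field_simps)
        also have "\<dots> \<le> max 0 (hi $ j - lo $ j + 2 / real b ^ K) * real b ^ K"
          by (intro mult_right_mono) auto
        finally show ?thesis .
      qed simp
      then show "real (outer_hi K (hi $ j) - outer_lo K (lo $ j)) / real b ^ K \<le> max 0 (hi $ j - lo $ j + 2 / real b ^ K)"
        using B[of K] by (simp add: pos_divide_le_eq)
    qed simp
    finally show "prob (hit lo hi u) \<le> (\<Prod>j\<in>UNIV. max 0 (hi $ j - lo $ j + 2 / real b ^ K))" .
  qed
  show "(\<Prod>j\<in>UNIV. hi $ j - lo $ j) \<le> prob (hit lo hi u)"
  proof (rule LIMSEQ_le_const2[OF prod_tendsto_volume[of lo hi "-2"]], simp add: lh', intro exI[of _ 0] allI impI)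
    fix K :: nat
    have q: "outer_lo K (hi $ j) \<le> b ^ K" for j
      using outer_bounds(1,6)[OF lh'(3)[of j] lh'(4)[of j], of K] by linarith
    have "(\<Prod>j\<in>UNIV. max 0 (hi $ j - lo $ j + - 2 / real b ^ K)) \<le>
        (\<Prod>j\<in>UNIV. real (outer_lo K (hi $ j) - outer_hi K (lo $ j)) / real b ^ K)"
    proof (intro prod_mono conjI)
      fix j
      have "(hi $ j - lo $ j + - 2 / real b ^ K) * real b ^ K = (hi $ j * real b ^ K - 1) - (lo $ j * real b ^ K + 1)"
        using B[of K] by (simp add: field_simps)
      also have "\<dots> \<le> real (outer_lo K (hi $ j) - outer_hi K (lo $ j))"
        using outer_bounds(4)[OF lh'(3)[of j] lh'(4)[of j], of K] outer_bounds(3)[OF lh'(1)[of j] lh'(2)[of j], of K] by linarith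
      finally show "max 0 (hi $ j - lo $ j + - 2 / real b ^ K) \<le> real (outer_lo K (hi $ j) - outer_hi K (lo $ j)) / real b ^ K"
        using B[of K] by (simp add: pos_le_divide_eq)
    qed simp
    also have "\<dots> = prob {\<omega> \<in> space M. \<forall>j. X K (u $ j) j \<omega> \<in> {outer_hi K (lo $ j)..<outer_lo K (hi $ j)}}"
      by (intro prob_prefix_in(2)[symmetric] q)
    also have "\<dots> \<le> prob (hit lo hi u)"
      by (rule finite_measure_mono[OF _ hit_events]) (auto intro!: hit_inner simp del: atLeastLessThan_iff)
    finally show "(\<Prod>j\<in>UNIV. max 0 (hi $ j - lo $ j + - 2 / real b ^ K)) \<le> prob (hit lo hi u)" .
  qed
qed

text \<open>For each \<open>K > m\<close> the grid is fine enough to separate all net points, and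
  the bound holds with the volume of the enclosing grid box. Letting \<open>K\<close> grow removes
  the excess volume.\<close>

lemma sum_prob_hit_pairs_le:
  assumes P: "zero_net b m P" and s: "CARD('s) \<le> b"
    and lh: "\<And>j. 0 \<le> lo $ j \<and> lo $ j < hi $ j \<and> hi $ j \<le> 1"
  shows "(\<Sum>(u, v)\<in>{(u, v). u \<in> P \<and> v \<in> P \<and> u \<noteq> v}. prob (hit lo hi u \<inter> hit lo hi v)) \<le>
    real b ^ m * (real b ^ m - 1) * (\<Prod>j\<in>UNIV. hi $ j - lo $ j)\<^sup>2"
proof -
  let ?D = "{(u, v). u \<in> P \<and> v \<in> P \<and> u \<noteq> v}"
  let ?S = "\<Sum>(u, v)\<in>?D. prob (hit lo hi u \<inter> hit lo hi v)"
  have lh': "0 \<le> lo $ j" "lo $ j \<le> 1" "0 \<le> hi $ j" "hi $ j \<le> 1" "lo $ j \<le> hi $ j" for j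
    using lh[of j] by auto
  have B: "real b ^ K > 0" for K using b by simp
  have step: "?S \<le> real b ^ m * (real b ^ m - 1) * (\<Prod>j\<in>UNIV. max 0 (hi $ j - lo $ j + 2 / real b ^ K))\<^sup>2"
    if K: "Suc m \<le> K" for K
  proof -
    define p where "p = (\<lambda>j. outer_lo K (lo $ j))"
    define q where "q = (\<lambda>j. outer_hi K (hi $ j))"
    have q: "q j \<le> b ^ K" for j unfolding q_def by (intro outer_bounds lh')
    have pq: "p j < q j" for j
    proof -
      have lt: "lo $ j * real b ^ K < hi $ j * real b ^ K" using lh[of j] B[of K] by simp
      then have "real (p j) < real (q j)"
        using outer_bounds(5)[OF lh'(1)[of j] lh'(2)[of j], of K] outer_bounds(2)[OF lh'(3)[of j] lh'(4)[of j], of K]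
        unfolding p_def q_def by linarith
      then show ?thesis by simp
    qed
    have le: "(\<Prod>j\<in>UNIV. (real (q j) - real (p j)) / real b ^ K) \<le> (\<Prod>j\<in>UNIV. max 0 (hi $ j - lo $ j + 2 / real b ^ K))"
    proof (intro prod_mono conjI)
      fix j
      show "0 \<le> (real (q j) - real (p j)) / real b ^ K" using pq[of j] by simp
      have "real (q j) - real (p j) \<le> (hi $ j * real b ^ K + 1) - (lo $ j * real b ^ K - 1)"
        using outer_bounds(3)[OF lh'(3)[of j] lh'(4)[of j], of K] outer_bounds(4)[OF lh'(1)[of j] lh'(2)[of j], of K]
        unfolding p_def q_def by linarith
      also have "\<dots> = (hi $ j - lo $ j + 2 / real b ^ K) * real b ^ K" using B[of K] by (simp add: field_simps)
      finally have "(real (q j) - real (p j)) / real b ^ K \<le> hi $ j - lo $ j + 2 / real b ^ K"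
        using B[of K] by (simp add: pos_divide_le_eq)
      then show "(real (q j) - real (p j)) / real b ^ K \<le> max 0 (hi $ j - lo $ j + 2 / real b ^ K)" by simp
    qed
    have "?S \<le> (\<Sum>(u, v)\<in>?D. \<Prod>j\<in>UNIV. \<Sum>k\<le>common_digits b (u $ j) (v $ j).
        real b ^ k * interval_weight b K (p j) (q j) k)"
    proof (rule sum_mono, clarify)
      fix u v assume uv: "u \<in> P" "v \<in> P" "u \<noteq> v"
      note cu = zero_net_coord[OF P uv(1)] and cv = zero_net_coord[OF P uv(2)]
      note cd = common_digits[OF b cu cv zero_net_separated[OF b P uv]]
      have cdK: "common_digits b (u $ j) (v $ j) < K" for j
        using cd(1)[of j] K by linarith
      have "hit lo hi u \<inter> hit lo hi v \<subseteq> {\<omega> \<in> space M. \<forall>j. (X K (u $ j) j \<omega>, X K (v $ j) j \<omega>) \<in> {p j..<q j} \<times> {p j..<q j}}"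
        unfolding p_def q_def using hit_outer by (auto simp: hit_def simp del: atLeastLessThan_iff)
      then have "prob (hit lo hi u \<inter> hit lo hi v) \<le>
          prob {\<omega> \<in> space M. \<forall>j. (X K (u $ j) j \<omega>, X K (v $ j) j \<omega>) \<in> {p j..<q j} \<times> {p j..<q j}}"
        by (rule finite_measure_mono) (rule prob_prefix_pair_in(1)[OF cu cv cd(2) cdK q])
      also have "\<dots> = (\<Prod>j\<in>UNIV. \<Sum>k\<le>common_digits b (u $ j) (v $ j).
          real b ^ k * interval_weight b K (p j) (q j) k)"
        by (rule prob_prefix_pair_in(2)[OF cu cv cd(2) cdK q])
      finally show "prob (hit lo hi u \<inter> hit lo hi v) \<le> (\<Prod>j\<in>UNIV. \<Sum>k\<le>common_digits b (u $ j) (v $ j).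
          real b ^ k * interval_weight b K (p j) (q j) k)" .
    qed
    also have "\<dots> \<le> real b ^ m * (real b ^ m - 1) * (\<Prod>j\<in>UNIV. \<Sum>k\<le>K. interval_weight b K (p j) (q j) k)"
      by (rule net_pair_sum_le[OF b s P]) (use K in \<open>auto intro!: admissible_interval_weight b pq q\<close>)
    also have "(\<Prod>j\<in>UNIV. \<Sum>k\<le>K. interval_weight b K (p j) (q j) k) = (\<Prod>j\<in>UNIV. (real (q j) - real (p j)) / real b ^ K)\<^sup>2"
      unfolding prod_power_distrib
      by (intro prod.cong refl sum_interval_weight[OF b _ less_imp_le[OF pq] q]) (use K in simp)
    also have "real b ^ m * (real b ^ m - 1) * (\<Prod>j\<in>UNIV. (real (q j) - real (p j)) / real b ^ K)\<^sup>2 \<le>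
        real b ^ m * (real b ^ m - 1) * (\<Prod>j\<in>UNIV. max 0 (hi $ j - lo $ j + 2 / real b ^ K))\<^sup>2"
      by (intro mult_left_mono power_mono le prod_nonneg) (use b pq in \<open>auto simp: less_imp_le\<close>)
    finally show ?thesis .
  qed
  have "(\<lambda>K. real b ^ m * (real b ^ m - 1) * (\<Prod>j\<in>UNIV. max 0 (hi $ j - lo $ j + 2 / real b ^ K))\<^sup>2) \<longlonglongrightarrow>
      real b ^ m * (real b ^ m - 1) * (\<Prod>j\<in>UNIV. hi $ j - lo $ j)\<^sup>2"
    by (intro tendsto_mult tendsto_const tendsto_power prod_tendsto_volume lh')
  then show ?thesis by (rule LIMSEQ_le_const) (use step in blast)
qed

end

theorem proposition4:
  fixes b m n :: nat
    and P :: "(real ^ 's::finite) set"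
    and M :: "'w measure"
    and \<pi> :: "'s \<Rightarrow> nat list \<Rightarrow> 'w \<Rightarrow> nat \<Rightarrow> nat"
    and lo hi :: "real ^ 's"
    and A :: "(real ^ 's) set"
    and \<mu> :: real
  assumes "b \<ge> 2" and "m \<ge> 1" and "CARD('s) \<le> b"
    and "n = b ^ m"
    and "zero_net b m P"
    and "nested_uniform_perms M b \<pi>"
    and "\<And>j. 0 \<le> lo $ j \<and> lo $ j < hi $ j \<and> hi $ j \<le> 1"
    and "A = half_open_box lo hi"
    and "\<mu> = measure lborel A"
  shows "prob_space.variance M (\<lambda>\<omega>. scrambled_estimate b P A (\<lambda>j w. \<pi> j w \<omega>))
           \<le> \<mu> * (1 - \<mu>) / real n"
proof -
  interpret nested_scrambling M b \<pi>
    using assms(1,6) by (auto simp: nested_scrambling_def nested_scrambling_axioms_def nested_uniform_perms_def)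
  have P: "finite P" "card P = n" using assms(4,5) by (auto simp: zero_net_def)
  have n: "n > 0" using assms(1,4) by simp
  have \<mu>: "\<mu> = (\<Prod>j\<in>UNIV. hi $ j - lo $ j)"
    unfolding assms(8,9) by (rule measure_half_open_box) (use assms(7) less_imp_le in blast)
  have eq: "scrambled_estimate b P A (\<lambda>j w. \<pi> j w \<omega>) = (\<Sum>u\<in>P. indicator (hit lo hi u) \<omega>) / real (card P)"
    if "\<omega> \<in> space M" for \<omega>
    using that by (simp add: scrambled_estimate_def hit_def assms(8) indicator_def)
  have "variance (\<lambda>\<omega>. scrambled_estimate b P A (\<lambda>j w. \<pi> j w \<omega>)) =
      variance (\<lambda>\<omega>. (\<Sum>u\<in>P. indicator (hit lo hi u) \<omega>) / real (card P))"
    by (simp add: eq cong: Bochner_Integration.integral_cong)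
  also have "\<dots> \<le> \<mu> * (1 - \<mu>) / real (card P)"
  proof (rule variance_average_indicators_le)
    show "P \<noteq> {}" using P n by auto
    show "prob (hit lo hi u) = \<mu>" for u unfolding \<mu> by (rule prob_hit[OF assms(7)])
    show "(\<Sum>(u, v)\<in>{(u, v). u \<in> P \<and> v \<in> P \<and> u \<noteq> v}. prob (hit lo hi u \<inter> hit lo hi v)) \<le>
        real (card P) * (real (card P) - 1) * \<mu>\<^sup>2"
      using sum_prob_hit_pairs_le[OF assms(5,3,7)] by (simp add: P(2) assms(4) \<mu>)
  qed (use P hit_events in auto)
  finally show ?thesis using P by simp
qed

end
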